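(* Let $\alpha,\beta,v\in\mathbb R$ with $|\alpha-\beta|<|v|<\alpha+\beta+2$, let $W$ be the $2\times2$ Jacobi-type weight and $\mathcal V,\mathcal N$ the differential operators defined in the context, and let $$D_1=\mathcal N\begin{pmatrix}1&0\\0&0\end{pmatrix}\mathcal V,\quad D_2=\mathcal N\begin{pmatrix}0&1\\0&0\end{pmatrix}\mathcal V,\quad D_3=\mathcal N\begin{pmatrix}0&0\\1&0\end{pmatrix}\mathcal V,\quad D_4=\mathcal N\begin{pmatrix}0&0\\0&1\end{pmatrix}\mathcal V,\quad D_5=D_1+D_4.$$ Then the algebra $\mathcal D(W)$ is generated as a module over its center $\mathcal Z(W)$ by the set $\{I,\,D_j,\,D_5D_j: j=1,2,3,4\}$.
   Context: The weight: $W(x)=(1-x)^\alpha(1+x)^\beta\big(W_2\frac{(1-x)^2}{4}+W_1\frac{1-x}{2}+W_0\big)$ for $x\in(-1,1)$, where $$W_2=\begin{pmatrix}\frac{v(v+2+\alpha+\beta)}{v+\alpha-\beta}&0\\0&\frac{v(-v+2+\alpha+\beta)}{v-\alpha+\beta}\end{pmatrix},\quad W_1=\begin{pmatrix}-(v+\alpha+\beta+2)&\alpha+\beta+2\\\alpha+\beta+2&-(-v+\alpha+\beta+2)\end{pmatrix},\quad W_0=\begin{pmatrix}\alpha+1&-\alpha-1\\-\alpha-1&\alpha+1\end{pmatrix}.$$ The operators: $$\mathcal V=\partial\begin{pmatrix}x+\frac{\beta-\alpha}{v}&1+\frac{\beta-\alpha}{v}\\1+\frac{\alpha-\beta}{v}&x+\frac{\alpha-\beta}{v}\end{pmatrix}+\begin{pmatrix}\frac{v+2+\alpha+\beta}{2}&0\\0&\frac{-v+2+\alpha+\beta}{2}\end{pmatrix},$$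 $$\mathcal N=\partial\begin{pmatrix}-x+\frac{\beta-\alpha}{v}&1+\frac{\beta-\alpha}{v}\\1+\frac{\alpha-\beta}{v}&-x+\frac{\alpha-\beta}{v}\end{pmatrix}+\begin{pmatrix}-\frac12(-v+4+\alpha+\beta)&0\\0&-\frac12(\alpha+\beta+v+4)\end{pmatrix}.$$ Conventions: $\{P_n\}$ denotes the monic matrix polynomials orthogonal for $\langle P,Q\rangle_W=\int_{-1}^1P(x)W(x)Q(x)^*dx$. Matrix differential operators $D=\sum_j\partial^jF_j(x)$ with $F_j\in\operatorname{Mat}_2(\mathbb C[x])$, forming the algebra $\operatorname{Mat}_2(\Omega[x])$, act on the right: $P\cdot D=\sum_j\partial^j(P)F_j$, and $P\cdot(DE)=(P\cdot D)\cdot E$. $\mathcal D(W)=\{D\in\operatorname{Mat}_2(\Omega[x]):\text{for all }n\ge0,\ P_n\cdot D=\Lambda_n(D)P_n\text{ for some }\Lambda_n(D)\in\operatorname{Mat}_2(\mathbb C)\}$, and $\mathcal Z(W)$ is its center. *)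

theory Defs
  imports "HOL-Analysis.Analysis" "HOL-Computational_Algebra.Polynomial"
begin

definition mat2 :: "'a::zero \<Rightarrow> 'a \<Rightarrow> 'a \<Rightarrow> 'a \<Rightarrow> 'a^2^2" where
  "mat2 a b c d = vector [vector [a, b], vector [c, d]]"

type_synonym mpoly2 = "complex poly^2^2"

definition mpoly_eval :: "mpoly2 \<Rightarrow> real \<Rightarrow> complex^2^2" where
  "mpoly_eval P x = (\<chi> i j. poly (P $ i $ j) (complex_of_real x))"

definition mpoly_deriv :: "mpoly2 \<Rightarrow> mpoly2" where
  "mpoly_deriv P = (\<chi> i j. pderiv (P $ i $ j))"

definition mpoly_const :: "complex^2^2 \<Rightarrow> mpoly2" where
  "mpoly_const A = (\<chi> i j. [:A $ i $ j:])"

definition mpoly_coeff :: "mpoly2 \<Rightarrow> nat \<Rightarrow> complex^2^2" where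
  "mpoly_coeff P n = (\<chi> i j. coeff (P $ i $ j) n)"

definition mpoly_monic :: "nat \<Rightarrow> mpoly2 \<Rightarrow> bool" where
  "mpoly_monic n P \<longleftrightarrow> mpoly_coeff P n = mat 1 \<and> (\<forall>m>n. mpoly_coeff P m = 0)"

text \<open>The operator \<open>\<Sum>\<^sub>j \<partial>\<^sup>j F\<^sub>j(x)\<close> is encoded as the polynomial in \<open>\<partial>\<close> with
  coefficients \<open>F\<^sub>j\<close>; thus \<open>[:F\<^sub>0, F\<^sub>1:]\<close> stands for \<open>\<partial> F\<^sub>1 + F\<^sub>0\<close>. Only the additive structure
  of the type of polynomials is meaningful here: the multiplication of operators is \<open>op_mult\<close>
  below, not the multiplication of polynomials.\<close>

type_synonym diffop = "mpoly2 poly"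

definition op_act :: "mpoly2 \<Rightarrow> diffop \<Rightarrow> mpoly2"  (infixl "\<cdot>\<^sub>D" 70) where
  "P \<cdot>\<^sub>D D = (\<Sum>j\<le>degree D. (mpoly_deriv ^^ j) P ** coeff D j)"

text \<open>Leibniz' rule applied to \<open>\<partial>\<^sup>k(\<partial>\<^sup>j(P) F\<^sub>j) G\<^sub>k\<close>; lemma \<open>op_act_mult\<close> below is the
  defining property \<open>P \<cdot> (D E) = (P \<cdot> D) \<cdot> E\<close> of the product.\<close>

definition op_mult :: "diffop \<Rightarrow> diffop \<Rightarrow> diffop"  (infixl "\<otimes>\<^sub>D" 75) where
  "D \<otimes>\<^sub>D E = (\<Sum>j\<le>degree D. \<Sum>k\<le>degree E. \<Sum>i\<le>k.
     monom (mat (of_nat (k choose i)) ** (mpoly_deriv ^^ (k - i)) (coeff D j) ** coeff E k) (j + i))"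

definition op_one :: diffop where
  "op_one = [:mat 1:]"

lemma mpoly_deriv_add: "mpoly_deriv (P + Q) = mpoly_deriv P + mpoly_deriv Q"
  by (simp add: mpoly_deriv_def vec_eq_iff pderiv_add)

lemma mpoly_deriv_zero [simp]: "mpoly_deriv 0 = 0"
  by (simp add: mpoly_deriv_def vec_eq_iff)

lemma mpoly_deriv_sum: "mpoly_deriv (\<Sum>x\<in>A. f x) = (\<Sum>x\<in>A. mpoly_deriv (f x))"
  by (induction A rule: infinite_finite_induct) (auto simp: mpoly_deriv_add)

lemma mpoly_deriv_pow_add:
  "(mpoly_deriv ^^ k) (P + Q) = (mpoly_deriv ^^ k) P + (mpoly_deriv ^^ k) Q"
  by (induction k) (auto simp: mpoly_deriv_add)

lemma mpoly_deriv_pow_zero [simp]: "(mpoly_deriv ^^ k) 0 = 0"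
  by (induction k) auto

lemma mpoly_deriv_pow_sum:
  "(mpoly_deriv ^^ k) (\<Sum>x\<in>A. f x) = (\<Sum>x\<in>A. (mpoly_deriv ^^ k) (f x))"
  by (induction A rule: infinite_finite_induct) (auto simp: mpoly_deriv_pow_add)

lemma poly_pderiv_sum: "pderiv (\<Sum>x\<in>A. f x) = (\<Sum>x\<in>A. pderiv (f x :: complex poly))"
  by (induction A rule: infinite_finite_induct) (auto simp: pderiv_add)

lemma pderiv_pow_mult:
  fixes p q :: "complex poly"
  shows "(pderiv ^^ k) (p * q) =
    (\<Sum>i\<le>k. of_nat (k choose i) * ((pderiv ^^ i) p * (pderiv ^^ (k - i)) q))"
proof (induction k)
  case (Suc k)
  let ?f = "\<lambda>i. (pderiv ^^ i) p" and ?g = "\<lambda>i. (pderiv ^^ i) q"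
  have "(pderiv ^^ Suc k) (p * q) =
      (\<Sum>i\<le>k. of_nat (k choose i) * (?f i * ?g (Suc (k - i)) + ?f (Suc i) * ?g (k - i)))"
    unfolding funpow.simps(2) comp_apply Suc poly_pderiv_sum pderiv_mult pderiv_of_nat
    by (simp only: mult.commute mult_zero_left mult_zero_right add_0_right)
  also have "\<dots> = (\<Sum>i\<le>k. of_nat (k choose i) * (?f i * ?g (Suc (k - i)))) +
      (\<Sum>i\<le>k. of_nat (k choose i) * (?f (Suc i) * ?g (k - i)))"
    by (simp only: distrib_left sum.distrib)
  also have "(\<Sum>i\<le>k. of_nat (k choose i) * (?f i * ?g (Suc (k - i)))) =
      (\<Sum>i\<le>k. of_nat (k choose i) * (?f i * ?g (Suc k - i)))"
    by (rule sum.cong) (auto simp: Suc_diff_le)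
  also have "\<dots> = (\<Sum>i\<le>Suc k. of_nat (k choose i) * (?f i * ?g (Suc k - i)))"
    by (simp only: sum.atMost_Suc) simp
  also have "\<dots> = p * ?g (Suc k) + (\<Sum>i\<le>k. of_nat (k choose Suc i) * (?f (Suc i) * ?g (k - i)))"
    by (subst sum.atMost_Suc_shift) simp
  also have "\<dots> + (\<Sum>i\<le>k. of_nat (k choose i) * (?f (Suc i) * ?g (k - i))) = p * ?g (Suc k) +
      (\<Sum>i\<le>k. of_nat (Suc k choose Suc i) * (?f (Suc i) * ?g (k - i)))"
    by (simp only: binomial_Suc_Suc of_nat_add distrib_right sum.distrib add.assoc add.commute add.left_commute)
  also have "\<dots> = (\<Sum>i\<le>Suc k. of_nat (Suc k choose i) * (?f i * ?g (Suc k - i)))"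
    by (simp only: sum.atMost_Suc_shift) simp
  finally show ?case .
qed simp

lemma mpoly_deriv_pow_nth: "(mpoly_deriv ^^ k) P $ i $ j = (pderiv ^^ k) (P $ i $ j)"
  by (induction k) (auto simp: mpoly_deriv_def)

lemma mat_mult_nth: "(mat c ** (A :: mpoly2)) $ i $ j = c * A $ i $ j"
  by (simp add: matrix_matrix_mult_def mat_def if_distrib [where f = "\<lambda>x. x * _"] cong: if_cong)

lemma mpoly_deriv_pow_mult:
  "(mpoly_deriv ^^ k) (P ** Q) =
    (\<Sum>i\<le>k. mat (of_nat (k choose i)) ** ((mpoly_deriv ^^ i) P ** (mpoly_deriv ^^ (k - i)) Q))"
proof -
  have "(mpoly_deriv ^^ k) (P ** Q) $ a $ b =
    (\<Sum>i\<le>k. mat (of_nat (k choose i)) ** ((mpoly_deriv ^^ i) P ** (mpoly_deriv ^^ (k - i)) Q)) $ a $ b"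
    for a b
  proof -
    have "(mpoly_deriv ^^ k) (P ** Q) $ a $ b =
        (\<Sum>c\<in>UNIV. \<Sum>i\<le>k. of_nat (k choose i) *
          ((pderiv ^^ i) (P $ a $ c) * (pderiv ^^ (k - i)) (Q $ c $ b)))"
      by (simp only: mpoly_deriv_pow_nth matrix_matrix_mult_def vec_lambda_beta higher_pderiv_sum
            pderiv_pow_mult)
    also have "\<dots> = (\<Sum>i\<le>k. of_nat (k choose i) *
          (\<Sum>c\<in>UNIV. (pderiv ^^ i) (P $ a $ c) * (pderiv ^^ (k - i)) (Q $ c $ b)))"
      by (subst sum.swap) (simp only: sum_distrib_left)
    also have "\<dots> = (\<Sum>i\<le>k. mat (of_nat (k choose i)) **
        ((mpoly_deriv ^^ i) P ** (mpoly_deriv ^^ (k - i)) Q)) $ a $ b"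
      by (simp only: sum_component mat_mult_nth)
         (simp only: matrix_matrix_mult_def mpoly_deriv_pow_nth vec_lambda_beta)
    finally show ?thesis .
  qed
  then show ?thesis by (simp add: vec_eq_iff)
qed

lemma op_act_eq_sum:
  assumes "degree D \<le> n"
  shows "P \<cdot>\<^sub>D D = (\<Sum>j\<le>n. (mpoly_deriv ^^ j) P ** coeff D j)"
  unfolding op_act_def
  by (rule sum.mono_neutral_left) (use assms in \<open>auto simp: coeff_eq_0\<close>)

lemma op_act_add: "P \<cdot>\<^sub>D (D + E) = P \<cdot>\<^sub>D D + P \<cdot>\<^sub>D E"
proof -
  let ?n = "max (degree D) (degree E)"
  have "degree (D + E) \<le> ?n" by (rule degree_add_le_max)
  then show ?thesis
    by (simp add: op_act_eq_sum [where n = ?n] matrix_add_ldistrib sum.distrib)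
qed

lemma op_act_zero [simp]: "P \<cdot>\<^sub>D 0 = 0"
  by (simp add: op_act_def)

lemma op_act_sum: "P \<cdot>\<^sub>D (\<Sum>x\<in>A. f x) = (\<Sum>x\<in>A. P \<cdot>\<^sub>D f x)"
  by (induction A rule: infinite_finite_induct) (auto simp: op_act_add)

lemma op_act_monom: "P \<cdot>\<^sub>D monom F n = (mpoly_deriv ^^ n) P ** F"
proof -
  have "P \<cdot>\<^sub>D monom F n = (\<Sum>j\<le>n. (mpoly_deriv ^^ j) P ** coeff (monom F n) j)"
    by (rule op_act_eq_sum) (rule degree_monom_le)
  also have "\<dots> = (\<Sum>j\<in>{n}. (mpoly_deriv ^^ j) P ** coeff (monom F n) j)"
    by (rule sum.mono_neutral_right) auto
  finally show ?thesis by simp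
qed

lemma mat_commute: "A ** mat c = mat c ** (A :: mpoly2)"
  by (simp add: vec_eq_iff mat_mult_nth)
     (simp add: matrix_matrix_mult_def mat_def if_distrib [where f = "\<lambda>x. _ * x"] mult.commute cong: if_cong)

lemma mpoly_mult_sum_left: "(\<Sum>x\<in>A. f x) ** (B :: mpoly2) = (\<Sum>x\<in>A. f x ** B)"
  by (simp add: vec_eq_iff matrix_matrix_mult_def sum_distrib_right) (subst sum.swap, simp)

theorem op_act_mult: "P \<cdot>\<^sub>D (D \<otimes>\<^sub>D E) = (P \<cdot>\<^sub>D D) \<cdot>\<^sub>D E"
proof -
  have "(P \<cdot>\<^sub>D D) \<cdot>\<^sub>D E = (\<Sum>k\<le>degree E. \<Sum>j\<le>degree D.
      (mpoly_deriv ^^ k) ((mpoly_deriv ^^ j) P ** coeff D j) ** coeff E k)"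
    by (simp add: op_act_def [of _ E] op_act_def [of _ D] mpoly_deriv_pow_sum mpoly_mult_sum_left)
  also have "\<dots> = (\<Sum>j\<le>degree D. \<Sum>k\<le>degree E.
      (mpoly_deriv ^^ k) ((mpoly_deriv ^^ j) P ** coeff D j) ** coeff E k)"
    by (rule sum.swap)
  also have "\<dots> = P \<cdot>\<^sub>D (D \<otimes>\<^sub>D E)"
  proof -
    have "mat (of_nat c) ** ((mpoly_deriv ^^ i) ((mpoly_deriv ^^ j) P) ** F) ** G =
        (mpoly_deriv ^^ (j + i)) P ** (mat (of_nat c) ** F ** G)" for c i j and F G :: mpoly2
    proof -
      have "(mpoly_deriv ^^ i) ((mpoly_deriv ^^ j) P) = (mpoly_deriv ^^ (j + i)) P"
        by (simp add: funpow_add add.commute [of j i])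
      moreover have "mat (of_nat c) ** (mpoly_deriv ^^ (j + i)) P =
          (mpoly_deriv ^^ (j + i)) P ** mat (of_nat c)"
        by (rule mat_commute [symmetric])
      ultimately show ?thesis by (simp only: matrix_mul_assoc)
    qed
    then show ?thesis
      by (simp only: op_mult_def op_act_sum op_act_monom mpoly_deriv_pow_mult mpoly_mult_sum_left)
  qed
  finally show ?thesis by simp
qed

definition conj_transpose :: "complex^2^2 \<Rightarrow> complex^2^2" where
  "conj_transpose A = (\<chi> i j. cnj (A $ j $ i))"

definition weight_inner :: "(real \<Rightarrow> complex^2^2) \<Rightarrow> mpoly2 \<Rightarrow> mpoly2 \<Rightarrow> complex^2^2" where
  "weight_inner W P Q =
     (LBINT x:{-1<..<1}. mpoly_eval P x ** W x ** conj_transpose (mpoly_eval Q x))"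

definition is_monic_OPS :: "(real \<Rightarrow> complex^2^2) \<Rightarrow> (nat \<Rightarrow> mpoly2) \<Rightarrow> bool" where
  "is_monic_OPS W P \<longleftrightarrow> (\<forall>n. mpoly_monic n (P n)) \<and>
     (\<forall>m n. m \<noteq> n \<longrightarrow> weight_inner W (P m) (P n) = 0)"

text \<open>The description is proper whenever \<open>W\<close> is a weight, i.e. almost everywhere positive
  definite with finite moments: the monic orthogonal sequence then exists and is unique.\<close>

definition monic_OPS :: "(real \<Rightarrow> complex^2^2) \<Rightarrow> nat \<Rightarrow> mpoly2" where
  "monic_OPS W = (THE P. is_monic_OPS W P)"

definition op_algebra :: "(real \<Rightarrow> complex^2^2) \<Rightarrow> diffop set" where
  "op_algebra W = {D. \<forall>n. \<exists>\<Lambda>. monic_OPS W n \<cdot>\<^sub>D D = mpoly_const \<Lambda> ** monic_OPS W n}"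

definition op_center :: "diffop set \<Rightarrow> diffop set" where
  "op_center A = {Z \<in> A. \<forall>D\<in>A. Z \<otimes>\<^sub>D D = D \<otimes>\<^sub>D Z}"

text \<open>All finite \<open>R\<close>-linear combinations of elements of \<open>S\<close>. The coefficients are written on
  the left; for central \<open>R\<close> the side is irrelevant.\<close>

definition op_module_span :: "diffop set \<Rightarrow> diffop set \<Rightarrow> diffop set" where
  "op_module_span R S = {\<Sum>s\<in>T. r s \<otimes>\<^sub>D s | T r. finite T \<and> T \<subseteq> S \<and> r ` T \<subseteq> R}"

definition jacobi_W2 :: "real \<Rightarrow> real \<Rightarrow> real \<Rightarrow> real^2^2" where
  "jacobi_W2 \<alpha> \<beta> v = mat2
     (v * (v + 2 + \<alpha> + \<beta>) / (v + \<alpha> - \<beta>)) 0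
     0 (v * (- v + 2 + \<alpha> + \<beta>) / (v - \<alpha> + \<beta>))"

definition jacobi_W1 :: "real \<Rightarrow> real \<Rightarrow> real \<Rightarrow> real^2^2" where
  "jacobi_W1 \<alpha> \<beta> v = mat2
     (- (v + \<alpha> + \<beta> + 2)) (\<alpha> + \<beta> + 2)
     (\<alpha> + \<beta> + 2) (- (- v + \<alpha> + \<beta> + 2))"

definition jacobi_W0 :: "real \<Rightarrow> real^2^2" where
  "jacobi_W0 \<alpha> = mat2 (\<alpha> + 1) (- \<alpha> - 1) (- \<alpha> - 1) (\<alpha> + 1)"

text \<open>Only used for \<open>-1 < x < 1\<close>, where both bases of \<open>powr\<close> are positive.\<close>

definition jacobi_weight :: "real \<Rightarrow> real \<Rightarrow> real \<Rightarrow> real \<Rightarrow> complex^2^2" where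
  "jacobi_weight \<alpha> \<beta> v x = map_matrix complex_of_real
     (((1 - x) powr \<alpha> * (1 + x) powr \<beta>) *\<^sub>R
       (((1 - x)\<^sup>2 / 4) *\<^sub>R jacobi_W2 \<alpha> \<beta> v + ((1 - x) / 2) *\<^sub>R jacobi_W1 \<alpha> \<beta> v + jacobi_W0 \<alpha>))"

definition op_V :: "real \<Rightarrow> real \<Rightarrow> real \<Rightarrow> diffop" where
  "op_V \<alpha> \<beta> v =
    [: mat2 [:of_real ((v + 2 + \<alpha> + \<beta>) / 2):] 0
            0 [:of_real ((- v + 2 + \<alpha> + \<beta>) / 2):],
       mat2 [:of_real ((\<beta> - \<alpha>) / v), 1:] [:of_real (1 + (\<beta> - \<alpha>) / v):]
            [:of_real (1 + (\<alpha> - \<beta>) / v):] [:of_real ((\<alpha> - \<beta>) / v), 1:] :]"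

definition op_N :: "real \<Rightarrow> real \<Rightarrow> real \<Rightarrow> diffop" where
  "op_N \<alpha> \<beta> v =
    [: mat2 [:of_real (- (- v + 4 + \<alpha> + \<beta>) / 2):] 0
            0 [:of_real (- (\<alpha> + \<beta> + v + 4) / 2):],
       mat2 [:of_real ((\<beta> - \<alpha>) / v), - 1:] [:of_real (1 + (\<beta> - \<alpha>) / v):]
            [:of_real (1 + (\<alpha> - \<beta>) / v):] [:of_real ((\<alpha> - \<beta>) / v), - 1:] :]"

definition op_D1 :: "real \<Rightarrow> real \<Rightarrow> real \<Rightarrow> diffop" where
  "op_D1 \<alpha> \<beta> v = op_N \<alpha> \<beta> v \<otimes>\<^sub>D [:mat2 1 0 0 0:] \<otimes>\<^sub>D op_V \<alpha> \<beta> v"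

definition op_D2 :: "real \<Rightarrow> real \<Rightarrow> real \<Rightarrow> diffop" where
  "op_D2 \<alpha> \<beta> v = op_N \<alpha> \<beta> v \<otimes>\<^sub>D [:mat2 0 1 0 0:] \<otimes>\<^sub>D op_V \<alpha> \<beta> v"

definition op_D3 :: "real \<Rightarrow> real \<Rightarrow> real \<Rightarrow> diffop" where
  "op_D3 \<alpha> \<beta> v = op_N \<alpha> \<beta> v \<otimes>\<^sub>D [:mat2 0 0 1 0:] \<otimes>\<^sub>D op_V \<alpha> \<beta> v"

definition op_D4 :: "real \<Rightarrow> real \<Rightarrow> real \<Rightarrow> diffop" where
  "op_D4 \<alpha> \<beta> v = op_N \<alpha> \<beta> v \<otimes>\<^sub>D [:mat2 0 0 0 1:] \<otimes>\<^sub>D op_V \<alpha> \<beta> v"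

definition op_D5 :: "real \<Rightarrow> real \<Rightarrow> real \<Rightarrow> diffop" where
  "op_D5 \<alpha> \<beta> v = op_D1 \<alpha> \<beta> v + op_D4 \<alpha> \<beta> v"

end

theory Submission
  imports Defs
begin

text \<open>The weight comes from a scalar Jacobi weight by a Darboux transformation. Put
\<open>u1 = (v + 2 + \<alpha> + \<beta>) / 2\<close>, \<open>u2 = (- v + 2 + \<alpha> + \<beta>) / 2\<close>, \<open>a = (\<beta> - \<alpha>) / v\<close> and write
\<open>V = \<partial> V1 + V0\<close>, \<open>N = \<partial> N1 + N0\<close>. Then \<open>V1 N1 = (1 - x\<^sup>2) I\<close>, and \<open>V N\<close> is a diagonal matrix whose
entries are, up to sign and additive constants, the Jacobi operator \<open>\<delta>\<close> for the exponents
\<open>\<alpha> + 1, \<beta> + 1\<close> (lemma \<open>act_V_N\<close>); the weight itself is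
\<open>(1 - x)\<^sup>\<alpha> (1 + x)\<^sup>\<beta> N1 K N1\<^sup>T\<close> with a positive diagonal matrix \<open>K\<close> (lemma \<open>weight_entry\<close>).
Hence, if \<open>q\<^sub>n\<close> are the monic scalar Jacobi polynomials, with \<open>\<delta> q\<^sub>n = \<lambda>\<^sub>n q\<^sub>n\<close>, one has
\<open>q\<^sub>n I \<cdot> V = B\<^sub>n P\<^sub>n\<close> and \<open>P\<^sub>n \<cdot> N = A\<^sub>n q\<^sub>n\<close>, where \<open>P\<^sub>n\<close> are the monic orthogonal polynomials of
the weight (lemma \<open>monic_OPS_eq\<close>) and \<open>A\<^sub>n\<close>, \<open>B\<^sub>n\<close> are diagonal with entries linear in \<open>n\<close>.

An operator of the algebra is determined by its eigenvalue sequence \<open>\<Lambda>\<^sub>n\<close>, products go to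
products, and so everything is a question about sequences of \<open>2 \<times> 2\<close> matrices. For a matrix
polynomial \<open>X\<close> the operator \<open>N X(\<delta>) V\<close> belongs to the algebra and has eigenvalue
\<open>A\<^sub>n X(\<lambda>\<^sub>n) B\<^sub>n\<close>. The heart of the proof is the converse, lemma \<open>alg_eigenvalue_form\<close>: every
eigenvalue sequence is \<open>k I + A\<^sub>n X(\<lambda>\<^sub>n) B\<^sub>n\<close>. It rests on four observations.
\<^item> \<open>\<Lambda>\<^sub>n\<close> is polynomial in \<open>n\<close>: it is the coefficient of \<open>x\<^sup>n\<close> in \<open>x\<^sup>n \<cdot> D\<close>.
\<^item> \<open>B\<^sub>n \<Lambda>\<^sub>n A\<^sub>n\<close> is polynomial in \<open>\<lambda>\<^sub>n\<close>: it is the eigenvalue of \<open>V D N\<close> on \<open>q\<^sub>n I\<close>, and it can be read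
  off at the point \<open>1\<close>, where all derivatives of \<open>q\<^sub>n\<close> are \<open>q\<^sub>n(1)\<close> times a polynomial in \<open>\<lambda>\<^sub>n\<close>.
\<^item> As \<open>\<lambda>\<^sub>n\<close> is quadratic in \<open>n\<close>, every zero that the linear factors in \<open>A\<^sub>n\<close> and \<open>B\<^sub>n\<close> force on the
  polynomial in \<open>\<lambda>\<close> is a zero of \<open>M1\<close> or \<open>M2\<close>, the diagonal entries of \<open>A\<^sub>n B\<^sub>n\<close> as polynomials
  in \<open>\<lambda>\<^sub>n\<close>. Divisibility by these leaves only a constant diagonal matrix \<open>diag(k1, k2)\<close>
  unaccounted for.
\<^item> An operator with constant eigenvalue \<open>diag(k1, k2)\<close> has order zero, because the leading
  coefficient of \<open>V\<close> is not a zero divisor, and then \<open>k1 = k2\<close>, because \<open>P\<^sub>1\<close> is not diagonal.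

The center contains the operators with the scalar eigenvalues \<open>k + y(\<lambda>\<^sub>n) M1(\<lambda>\<^sub>n) M2(\<lambda>\<^sub>n)\<close>, while
\<open>D5\<close> multiplies the eigenvalues of \<open>D1, D2\<close> by \<open>M1(\<lambda>\<^sub>n)\<close> and those of \<open>D3, D4\<close> by \<open>M2(\<lambda>\<^sub>n)\<close>.
Division of the entries of \<open>X\<close> by the quadratic polynomial \<open>M1 M2\<close>, with remainders written as combinations of \<open>1\<close> and \<open>M1\<close> or \<open>M2\<close>, gives
the generation statement.\<close>

section \<open>Matrix polynomials and operators\<close>

lemmas mat2_simps = vec_eq_iff forall_2 matrix_matrix_mult_def sum_2

lemma mat2_nth [simp]:
  "mat2 a b c d $ 1 $ 1 = a" "mat2 a b c d $ 1 $ 2 = b"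
  "mat2 a b c d $ 2 $ 1 = c" "mat2 a b c d $ 2 $ 2 = d"
  by (simp_all add: mat2_def)

lemma mat_nth: "mat c $ i $ j = (if i = j then c else 0)"
  by (simp add: mat_def)

lemma mpoly_const_nth [simp]: "mpoly_const A $ i $ j = [:A $ i $ j:]"
  by (simp add: mpoly_const_def)

lemma mpoly_const_mult: "mpoly_const (A ** B) = mpoly_const A ** mpoly_const B"
  by (simp add: mat2_simps)

lemma mpoly_const_add_mult: "mpoly_const (C + D) ** P = mpoly_const C ** P + mpoly_const D ** P"
  by (simp add: mat2_simps smult_add_left)

lemma mpoly_const_diff_mult: "mpoly_const (C - D) ** P = mpoly_const C ** P - mpoly_const D ** P"
  by (simp add: mat2_simps smult_diff_left)

lemma mpoly_const_mat: "mpoly_const (mat c) = mat [:c:]"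
  by (simp add: vec_eq_iff mat_nth)

lemma mpoly_coeff_const_mult: "mpoly_coeff (mpoly_const C ** P) n = C ** mpoly_coeff P n"
  by (simp add: mpoly_coeff_def mat2_simps)

lemma mpoly_coeff_add: "mpoly_coeff (P + Q) n = mpoly_coeff P n + mpoly_coeff Q n"
  by (simp add: mpoly_coeff_def mat2_simps)

lemma mpoly_coeff_diff: "mpoly_coeff (P - Q) n = mpoly_coeff P n - mpoly_coeff Q n"
  by (simp add: mpoly_coeff_def mat2_simps)

lemma mpoly_coeff_zero [simp]: "mpoly_coeff 0 n = 0"
  by (simp add: mpoly_coeff_def mat2_simps)

lemma mpoly_coeff_sum: "mpoly_coeff (\<Sum>x\<in>A. f x) n = (\<Sum>x\<in>A. mpoly_coeff (f x) n)"
  by (induction A rule: infinite_finite_induct) (auto simp: mpoly_coeff_add)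

lemma mpoly_eq_iff: "P = Q \<longleftrightarrow> (\<forall>n. mpoly_coeff P n = mpoly_coeff Q n)"
  by (auto simp: mpoly_coeff_def vec_eq_iff poly_eq_iff)

lemma mpoly_finite_degree: "\<exists>N. \<forall>n\<ge>N. mpoly_coeff P n = 0"
proof (intro exI allI impI)
  fix n assume "Suc (\<Sum>i\<in>UNIV. \<Sum>j\<in>UNIV. degree (P $ i $ j)) \<le> n"
  then have "degree (P $ i $ j) < n" for i j
    using exhaust_2 [of i] exhaust_2 [of j] by (auto simp: sum_2)
  then show "mpoly_coeff P n = 0"
    by (simp add: mpoly_coeff_def vec_eq_iff coeff_eq_0)
qed

lemma mpoly_monic_coeff:
  assumes "mpoly_monic n P"
  shows "mpoly_coeff P n = mat 1" "m > n \<Longrightarrow> mpoly_coeff P m = 0"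
  using assms by (auto simp: mpoly_monic_def)

text \<open>The monic polynomials \<open>P 0, \<dots>, P (N - 1)\<close> form a basis of the left module of polynomials of
degree below \<open>N\<close>: divide off the leading coefficient and repeat.\<close>

lemma monic_expansion:
  assumes "\<And>n. mpoly_monic n (P n)" and "\<And>m. m \<ge> N \<Longrightarrow> mpoly_coeff Q m = 0"
  shows "\<exists>C. Q = (\<Sum>n<N. mpoly_const (C n) ** P n)"
  using assms(2)
proof (induction N arbitrary: Q)
  case 0
  then show ?case by (simp add: mpoly_eq_iff)
next
  case (Suc N)
  define R where "R = Q - mpoly_const (mpoly_coeff Q N) ** P N"
  have "mpoly_coeff R m = 0" if "m \<ge> N" for m
  proof (cases "m = N")
    case True
    then show ?thesis
      by (simp add: R_def mpoly_coeff_diff mpoly_coeff_const_mult mpoly_monic_coeff(1) [OF assms(1)])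
  next
    case False
    with that show ?thesis
      by (simp add: R_def mpoly_coeff_diff mpoly_coeff_const_mult
          mpoly_monic_coeff(2) [OF assms(1)] Suc.prems)
  qed
  from Suc.IH [OF this] obtain C where C: "R = (\<Sum>n<N. mpoly_const (C n) ** P n)"
    by blast
  have "Q = R + mpoly_const (mpoly_coeff Q N) ** P N"
    by (simp add: R_def)
  also have "\<dots> = (\<Sum>n<Suc N. mpoly_const ((C(N := mpoly_coeff Q N)) n) ** P n)"
    by (simp add: C)
  finally show ?case by blast
qed

lemma op_act_nth:
  "(P \<cdot>\<^sub>D D) $ i $ j =
    (\<Sum>k\<le>degree D. \<Sum>l\<in>UNIV. (pderiv ^^ k) (P $ i $ l) * coeff D k $ l $ j)"
  by (simp only: op_act_def sum_component matrix_matrix_mult_def mpoly_deriv_pow_nth vec_lambda_beta)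

lemma op_act_add_left: "(P + Q) \<cdot>\<^sub>D D = P \<cdot>\<^sub>D D + Q \<cdot>\<^sub>D D"
  by (simp add: vec_eq_iff op_act_nth higher_pderiv_add distrib_right sum.distrib)

lemma op_act_zero_left [simp]: "0 \<cdot>\<^sub>D D = 0"
  by (simp add: op_act_def matrix_matrix_mult_def vec_eq_iff)

lemma op_act_sum_left: "(\<Sum>x\<in>A. f x) \<cdot>\<^sub>D D = (\<Sum>x\<in>A. f x \<cdot>\<^sub>D D)"
  by (induction A rule: infinite_finite_induct) (auto simp: op_act_add_left)

lemma mpoly_deriv_pow_const_mult:
  "(mpoly_deriv ^^ k) (mpoly_const C ** P) = mpoly_const C ** (mpoly_deriv ^^ k) P"
  by (induction k)
     (simp_all add: mat2_simps mpoly_deriv_def pderiv_add pderiv_smult)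

lemma op_act_const_left: "(mpoly_const C ** P) \<cdot>\<^sub>D D = mpoly_const C ** (P \<cdot>\<^sub>D D)"
proof -
  have *: "A ** (\<Sum>x\<in>S. f x) = (\<Sum>x\<in>S. A ** f x)" if "finite S" for A :: mpoly2 and S :: "nat set" and f
    using that by (induction S) (auto simp: matrix_add_ldistrib)
  show ?thesis
    by (simp add: op_act_def mpoly_deriv_pow_const_mult * matrix_mul_assoc)
qed

lemma op_act_pCons_0: "P \<cdot>\<^sub>D [:F:] = P ** F"
  by (simp add: op_act_def)

lemma op_act_first_order: "P \<cdot>\<^sub>D [:F, G:] = P ** F + mpoly_deriv P ** G"
  by (simp add: op_act_eq_sum [where n = 1])

lemma op_act_diff: "P \<cdot>\<^sub>D (D - E) = P \<cdot>\<^sub>D D - P \<cdot>\<^sub>D E"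
  using op_act_add [of P "D - E" E] by simp

lemma mpoly_deriv_pow_mat: "(mpoly_deriv ^^ k) (mat f) = mat ((pderiv ^^ k) f)"
  by (simp add: vec_eq_iff mpoly_deriv_pow_nth mat_nth)

lemma higher_pderiv_power_self: "(pderiv ^^ k) (monom 1 k) = [:fact k :: complex:]"
  by (rule poly_eqI) (auto simp: coeff_higher_pderiv coeff_pCons pochhammer_fact split: nat.splits)

lemma higher_pderiv_monom_above: "j > k \<Longrightarrow> (pderiv ^^ j) (monom (1 :: complex) k) = 0"
  by (rule poly_eqI) (simp add: coeff_higher_pderiv)

text \<open>If \<open>k\<close> is the lowest order that occurs in \<open>D\<close>, then \<open>x\<^sup>k\<close> meets only this term, higher
derivatives of \<open>x\<^sup>k\<close> being zero, and \<open>D\<close> maps it to \<open>k!\<close> times the coefficient of order \<open>k\<close>.\<close>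

lemma op_eq_0_if_scalar_act:
  assumes "\<And>f. mat f \<cdot>\<^sub>D D = 0"
  shows "D = 0"
proof (rule ccontr)
  assume "D \<noteq> 0"
  define k where "k = (LEAST k. coeff D k \<noteq> 0)"
  have k: "coeff D k \<noteq> 0"
    unfolding k_def by (rule LeastI_ex) (use \<open>D \<noteq> 0\<close> in \<open>auto simp: poly_eq_iff\<close>)
  have less: "coeff D j = 0" if "j < k" for j
    using not_less_Least [of j "\<lambda>k. coeff D k \<noteq> 0"] that by (auto simp: k_def)
  let ?m = "max k (degree D)"
  have "mat (monom 1 k) \<cdot>\<^sub>D D = (\<Sum>j\<le>?m. mat ((pderiv ^^ j) (monom 1 k)) ** coeff D j)"
    by (simp add: op_act_eq_sum [where n = ?m] mpoly_deriv_pow_mat)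
  also have "\<dots> = (\<Sum>j\<in>{k}. mat ((pderiv ^^ j) (monom 1 k)) ** coeff D j)"
  proof (rule sum.mono_neutral_right)
    have "mat ((pderiv ^^ j) (monom 1 k)) ** coeff D j = 0" if "j \<noteq> k" for j
    proof (cases "j < k")
      case True
      then show ?thesis by (simp add: less)
    next
      case False
      with that show ?thesis
        by (simp add: higher_pderiv_monom_above vec_eq_iff mat_mult_nth)
    qed
    then show "\<forall>j\<in>{..?m} - {k}. mat ((pderiv ^^ j) (monom 1 k)) ** coeff D j = 0"
      by auto
  qed auto
  also have "\<dots> = mat [:fact k:] ** coeff D k"
    by (simp add: higher_pderiv_power_self)
  finally have "mat [:fact k:] ** coeff D k = 0"
    using assms by metis
  then have "coeff D k = 0"
    by (simp add: vec_eq_iff mat_mult_nth)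
  with k show False by simp
qed

text \<open>An operator is known once its action on one monic sequence is. This turns identities between
operators of the algebra into identities between their eigenvalues.\<close>

lemma op_eq_if_basis_act:
  assumes "\<And>n. mpoly_monic n (P n)" and "\<And>n. P n \<cdot>\<^sub>D D = P n \<cdot>\<^sub>D E"
  shows "D = E"
proof -
  have "Q \<cdot>\<^sub>D (D - E) = 0" for Q
  proof -
    obtain N where "\<forall>n\<ge>N. mpoly_coeff Q n = 0"
      using mpoly_finite_degree by blast
    then obtain C where "Q = (\<Sum>n<N. mpoly_const (C n) ** P n)"
      using monic_expansion [of P, OF assms(1), of N Q] by blast
    then show ?thesis
      by (simp add: op_act_sum_left op_act_const_left op_act_diff assms(2))
  qed
  then have "D - E = 0"
    by (intro op_eq_0_if_scalar_act) auto
  then show ?thesis by simp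
qed

lemma op_eq_if_act: "D = E" if "\<And>P. P \<cdot>\<^sub>D D = P \<cdot>\<^sub>D E"
  using op_eq_0_if_scalar_act [of "D - E"] that by (simp add: op_act_diff)

lemma op_mult_add_left: "(D + E) \<otimes>\<^sub>D F = D \<otimes>\<^sub>D F + E \<otimes>\<^sub>D F"
  by (rule op_eq_if_act) (simp add: op_act_mult op_act_add op_act_add_left)

lemma op_mult_zero_left [simp]: "0 \<otimes>\<^sub>D F = 0"
  by (rule op_eq_if_act) (simp add: op_act_mult)

lemma op_mult_add_right: "D \<otimes>\<^sub>D (E + F) = D \<otimes>\<^sub>D E + D \<otimes>\<^sub>D F"
  by (rule op_eq_if_act) (simp add: op_act_mult op_act_add)

lemma op_mult_zero_right: "D \<otimes>\<^sub>D 0 = 0"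
  by (rule op_eq_if_act) (simp add: op_act_mult)

text \<open>The symbol of highest order is multiplicative: only the Leibniz term in which all derivatives
fall on the argument reaches the order \<open>degree D + degree E\<close>.\<close>

lemma coeff_op_mult_top:
  "coeff (D \<otimes>\<^sub>D E) (degree D + degree E) = coeff D (degree D) ** coeff E (degree E)"
proof -
  let ?d = "degree D" and ?e = "degree E"
  let ?G = "\<lambda>j k i. mat (of_nat (k choose i)) ** (mpoly_deriv ^^ (k - i)) (coeff D j) ** coeff E k"
  have "coeff (D \<otimes>\<^sub>D E) (?d + ?e) =
      (\<Sum>j\<le>?d. \<Sum>k\<le>?e. \<Sum>i\<le>k. if j = ?d \<and> k = ?e \<and> i = ?e then ?G j k i else 0)"
    unfolding op_mult_def coeff_sum coeff_monom
    by (intro sum.cong refl) auto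
  also have "\<dots> = (\<Sum>j\<le>?d. if j = ?d then \<Sum>k\<le>?e. if k = ?e then ?G ?d ?e ?e else 0 else 0)"
  proof (rule sum.cong [OF refl])
    fix j
    have "(\<Sum>i\<le>k. if j = ?d \<and> k = ?e \<and> i = ?e then ?G j k i else 0) =
        (if j = ?d then if k = ?e then ?G ?d ?e ?e else 0 else 0)" for k
      by (cases "j = ?d"; cases "k = ?e") simp_all
    then show "(\<Sum>k\<le>?e. \<Sum>i\<le>k. if j = ?d \<and> k = ?e \<and> i = ?e then ?G j k i else 0) =
        (if j = ?d then \<Sum>k\<le>?e. if k = ?e then ?G ?d ?e ?e else 0 else 0)"
      by simp
  qed
  also have "\<dots> = ?G ?d ?e ?e"
    by simp
  finally show ?thesis
    by simp
qed

section \<open>Scalar Jacobi polynomials and the Darboux factorization\<close>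

lemma poly_ext: "(\<And>x. poly p x = poly q x) \<Longrightarrow> p = q" for p q :: "complex poly"
  by (simp add: poly_eq_poly_eq_iff [symmetric] fun_eq_iff)

text \<open>The algebraic setting, with the parameters \<open>u1\<close>, \<open>u2\<close>, \<open>a\<close> explained above. In these terms
\<open>\<alpha> + 1 = ((1 - a) u1 + (1 + a) u2) / 2\<close>, \<open>\<beta> + 1 = ((1 + a) u1 + (1 - a) u2) / 2\<close> and
\<open>v = u1 - u2\<close>, so that \<open>c_nz\<close> says that \<open>\<alpha> + 1\<close> is not a nonpositive integer.\<close>

locale jacobi_darboux =
  fixes u1 u2 a :: complex
  assumes u1_nz: "of_nat n + u1 \<noteq> 0" and u2_nz: "of_nat n + u2 \<noteq> 0"
    and sum_nz: "of_nat n + (u1 + u2 + 1) \<noteq> 0"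
    and c_nz: "of_nat n + ((1 - a) * u1 + (1 + a) * u2) / 2 \<noteq> 0"
    and u_neq: "u1 \<noteq> u2"
    and a_nz: "1 + a \<noteq> 0" "1 - a \<noteq> 0"
begin

definition c :: complex where "c = ((1 - a) * u1 + (1 + a) * u2) / 2"

definition lam :: "nat \<Rightarrow> complex" where
  "lam n = of_nat n * (of_nat n + u1 + u2 + 1)"

lemma lam_inj: "lam m = lam n \<longleftrightarrow> m = n"
proof
  assume "lam m = lam n"
  then have "(of_nat m - of_nat n) * (of_nat (m + n) + (u1 + u2 + 1)) = 0"
    by (simp add: lam_def algebra_simps)
  then show "m = n"
    using sum_nz by (simp only: mult_eq_0_iff) auto
qed simp

text \<open>The Jacobi operator with exponents \<open>\<alpha> + 1\<close> and \<open>\<beta> + 1\<close>, its sign chosen such that the eigenvalue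
on degree \<open>n\<close> is \<open>lam n\<close>.\<close>

definition delta :: "complex poly \<Rightarrow> complex poly" where
  "delta f = [:-1, 0, 1:] * pderiv (pderiv f) + [:- a * (u1 - u2), u1 + u2 + 2:] * pderiv f"

text \<open>The Jacobi polynomial with value \<open>1\<close> at \<open>1\<close> is the hypergeometric sum
\<open>\<Sum>\<^sub>k h\<^sub>k (1 - x)\<^sup>k\<close> with \<open>2 (k + 1) (k + 1 + c) h\<^sub>k\<^sub>+\<^sub>1 = (lam k - lam n) h\<^sub>k\<close>. Here \<open>h\<^sub>k\<close> is recorded as
a polynomial in the eigenvalue \<open>lam n\<close>, since this dependence is what the sequel needs.\<close>

definition jac_coeff :: "nat \<Rightarrow> complex poly" where
  "jac_coeff k = (\<Prod>j<k. smult (1 / (2 * of_nat (Suc j) * (of_nat (Suc j) + c))) [:lam j, -1:])"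

definition jac_shifted :: "nat \<Rightarrow> complex poly" where
  "jac_shifted n = (\<Sum>k\<le>n. monom (poly (jac_coeff k) (lam n)) k)"

definition jac :: "nat \<Rightarrow> complex poly" where
  "jac n = jac_shifted n \<circ>\<^sub>p [:1, -1:]"

lemma Suc_c_nz: "of_nat (Suc j) + c \<noteq> 0"
  using c_nz [of "Suc j"] by (simp add: c_def)

lemma jac_coeff_denominator_nz: "2 * of_nat (Suc j) * (of_nat (Suc j) + c) \<noteq> 0"
  using Suc_c_nz [of j] of_nat_eq_0_iff [of "Suc j", where 'a = complex]
  by (simp only: mult_eq_0_iff) simp

lemma poly_jac_coeff_Suc:
  "2 * of_nat (Suc k) * (of_nat (Suc k) + c) * poly (jac_coeff (Suc k)) z = (lam k - z) * poly (jac_coeff k) z"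
proof -
  let ?d = "2 * of_nat (Suc k) * (of_nat (Suc k) + c)"
  have "jac_coeff (Suc k) = jac_coeff k * smult (1 / ?d) [:lam k, -1:]"
    by (simp only: jac_coeff_def prod.lessThan_Suc)
  then have "?d * poly (jac_coeff (Suc k)) z = ?d * (1 / ?d) * ((lam k - z) * poly (jac_coeff k) z)"
    by (simp only: poly_mult poly_smult poly_pCons poly_0) (simp only: mult_ac, simp)
  then show ?thesis
    using jac_coeff_denominator_nz [of k] by (metis times_divide_eq_right mult_1_right divide_self mult_1_left)
qed

text \<open>As the eigenvalues \<open>lam j\<close> are distinct, the factor \<open>lam n - lam n\<close> is the first and only one to
vanish: the hypergeometric sum terminates exactly at degree \<open>n\<close>.\<close>

lemma poly_jac_coeff_eq_0_iff: "poly (jac_coeff k) (lam n) = 0 \<longleftrightarrow> n < k"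
proof -
  have "poly (jac_coeff k) (lam n) = 0 \<longleftrightarrow> (\<exists>j<k. lam j = lam n)"
    unfolding jac_coeff_def poly_prod poly_smult poly_pCons poly_0
    using jac_coeff_denominator_nz
    by (subst prod_zero_iff) (auto simp del: of_nat_Suc)
  then show ?thesis
    by (auto simp: lam_inj)
qed

lemma coeff_jac_shifted: "coeff (jac_shifted n) k = poly (jac_coeff k) (lam n)"
proof -
  have "coeff (jac_shifted n) k = (if k \<le> n then poly (jac_coeff k) (lam n) else 0)"
    by (simp add: jac_shifted_def coeff_sum)
  then show ?thesis
    using poly_jac_coeff_eq_0_iff [of k n] by auto
qed

lemma degree_jac_shifted: "degree (jac_shifted n) = n"
proof (rule antisym)
  show "degree (jac_shifted n) \<le> n"
    by (rule degree_le) (simp add: coeff_jac_shifted poly_jac_coeff_eq_0_iff)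
  show "n \<le> degree (jac_shifted n)"
    by (rule le_degree) (simp add: coeff_jac_shifted poly_jac_coeff_eq_0_iff)
qed

lemma degree_jac: "degree (jac n) = n"
  by (simp add: jac_def degree_pcompose degree_jac_shifted)

text \<open>The Jacobi operator in the variable \<open>1 - x\<close>, in which its eigenvalue equation is a two-term
recursion.\<close>

lemma delta_pcompose:
  "delta (f \<circ>\<^sub>p [:1, -1:]) =
    ([:0, -2, 1:] * pderiv (pderiv f) + [:-2 * (1 + c), u1 + u2 + 2:] * pderiv f) \<circ>\<^sub>p [:1, -1:]"
proof -
  have 1: "pderiv (f \<circ>\<^sub>p [:1, -1:]) = - (pderiv f \<circ>\<^sub>p [:1, -1:])" for f :: "complex poly"
    by (simp add: pderiv_pcompose pderiv_pCons)
  have 2: "[:0, -2, 1:] \<circ>\<^sub>p [:1, -1:] = [:-1, 0, 1 :: complex:]"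
    "[:-2 * (1 + c), u1 + u2 + 2:] \<circ>\<^sub>p [:1, -1:] = - [:- a * (u1 - u2), u1 + u2 + 2:]"
    by (simp_all add: pcompose_pCons c_def field_simps)
  show ?thesis
    unfolding delta_def 1 pderiv_minus pcompose_add pcompose_mult 2
    by (intro poly_ext) (simp add: algebra_simps)
qed

lemma delta_jac: "delta (jac n) = smult (lam n) (jac n)"
proof -
  let ?f = "jac_shifted n"
  have "coeff ([:0, -2, 1:] * pderiv (pderiv ?f) + [:-2 * (1 + c), u1 + u2 + 2:] * pderiv ?f) k
      = lam k * coeff ?f k - 2 * of_nat (Suc k) * (of_nat (Suc k) + c) * coeff ?f (Suc k)" for k
    by (cases k rule: nat.exhaust; cases "k - 1" rule: nat.exhaust)
       (auto simp: coeff_pderiv coeff_pCons lam_def algebra_simps)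
  then have "[:0, -2, 1:] * pderiv (pderiv ?f) + [:-2 * (1 + c), u1 + u2 + 2:] * pderiv ?f
      = smult (lam n) ?f"
    by (intro poly_eqI) (simp only: coeff_jac_shifted poly_jac_coeff_Suc coeff_smult, simp add: algebra_simps)
  then show ?thesis
    by (simp only: jac_def delta_pcompose pcompose_smult)
qed

text \<open>The Taylor coefficients at the endpoint \<open>1\<close> depend polynomially on the eigenvalue. This is
special to the endpoint, where the leading coefficient of \<open>delta\<close> vanishes.\<close>

lemma higher_pderiv_jac_at_1:
  "poly ((pderiv ^^ k) (jac n)) 1 = (-1) ^ k * fact k * poly (jac_coeff k) (lam n)"
proof -
  have "(pderiv ^^ k) (f \<circ>\<^sub>p [:1, -1:]) = smult ((-1) ^ k) ((pderiv ^^ k) f \<circ>\<^sub>p [:1, -1:])" for f :: "complex poly"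
    by (induction k) (simp_all add: pderiv_smult pderiv_pcompose pderiv_pCons)
  then have "poly ((pderiv ^^ k) (jac n)) 1 = (-1) ^ k * coeff ((pderiv ^^ k) (jac_shifted n)) 0"
    by (simp add: jac_def poly_pcompose poly_0_coeff_0)
  then show ?thesis
    by (simp add: coeff_higher_pderiv coeff_jac_shifted pochhammer_fact)
qed

definition q :: "nat \<Rightarrow> complex poly" where
  "q n = smult (1 / lead_coeff (jac n)) (jac n)"

lemma lead_coeff_jac_nz: "lead_coeff (jac n) \<noteq> 0"
proof -
  have "jac n \<noteq> 0"
    using higher_pderiv_jac_at_1 [of 0 n] by (auto simp: jac_coeff_def)
  then show ?thesis by simp
qed

lemma degree_q: "degree (q n) = n"
  using lead_coeff_jac_nz [of n] by (simp add: q_def degree_jac)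

lemma coeff_q: "coeff (q n) n = 1"
  using lead_coeff_jac_nz [of n] by (simp add: q_def degree_jac)

lemma delta_smult: "delta (smult k f) = smult k (delta f)"
  by (simp add: delta_def pderiv_smult smult_add_right)

lemma delta_q: "delta (q n) = smult (lam n) (q n)"
  by (simp add: q_def delta_smult delta_jac mult.commute)

definition V :: diffop where
  "V = [: mat2 [:u1:] 0 0 [:u2:], mat2 [:a, 1:] [:1 + a:] [:1 - a:] [:-a, 1:] :]"

definition N :: diffop where
  "N = [: mat2 [:-(u2 + 1):] 0 0 [:-(u1 + 1):], mat2 [:a, -1:] [:1 + a:] [:1 - a:] [:-a, -1:] :]"

lemma act_V:
  "mat f \<cdot>\<^sub>D V = mat2 ([:a, 1:] * pderiv f + smult u1 f) (smult (1 + a) (pderiv f))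
     (smult (1 - a) (pderiv f)) ([:-a, 1:] * pderiv f + smult u2 f)"
  unfolding V_def op_act_first_order
  by (simp add: mat2_simps mpoly_deriv_def mat_nth algebra_simps)

text \<open>The leading coefficients of \<open>V\<close> and \<open>N\<close> are adjugate to each other up to sign, with
determinant \<open>x\<^sup>2 - 1\<close>; the entries \<open>\<plusminus>a\<close> and \<open>1 \<plusminus> a\<close> are such that \<open>a\<close> drops out of it.\<close>

lemma V_factor:
  "mat2 [:a, 1:] [:1 + a:] [:1 - a:] [:-a, 1:] ** mat2 [:a, -1:] [:1 + a:] [:1 - a:] [:-a, -1:] =
    mat [:1, 0, -1 :: complex:]"
  "mat2 [:a, -1:] [:1 + a:] [:1 - a:] [:-a, -1:] ** mat2 [:a, 1:] [:1 + a:] [:1 - a:] [:-a, 1:] =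
    mat [:1, 0, -1 :: complex:]"
  by (simp_all add: mat2_simps mat_nth algebra_simps)

text \<open>The second-order part is \<open>(1 - x\<^sup>2) \<partial>\<^sup>2\<close> by \<open>V_factor\<close>. The first-order part is diagonal because
the zero-order entries \<open>u1\<close>, \<open>u2\<close> of \<open>V\<close>, raised by one, reappear in \<open>N\<close> with opposite sign and in
exchanged places.\<close>

lemma act_V_N:
  "mat f \<cdot>\<^sub>D V \<cdot>\<^sub>D N = mat2 (- delta f - smult (u1 * (u2 + 1)) f) 0 0 (- delta f - smult (u2 * (u1 + 1)) f)"
  unfolding act_V unfolding N_def op_act_first_order
  by (simp add: mat2_simps mpoly_deriv_def delta_def pderiv_add pderiv_diff pderiv_mult pderiv_smult pderiv_pCons)
     (intro conjI poly_ext; simp add: algebra_simps)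

text \<open>The diagonal matrices \<open>B n\<close> and \<open>A n\<close> are the leading coefficients of \<open>q n I \<cdot> V\<close> and \<open>P n \<cdot> N\<close>; these
products have degree \<open>n\<close>.\<close>

definition B :: "nat \<Rightarrow> complex^2^2" where
  "B n = mat2 (of_nat n + u1) 0 0 (of_nat n + u2)"

definition A :: "nat \<Rightarrow> complex^2^2" where
  "A n = mat2 (- (of_nat n + u2 + 1)) 0 0 (- (of_nat n + u1 + 1))"

definition Binv :: "nat \<Rightarrow> complex^2^2" where
  "Binv n = mat2 (1 / (of_nat n + u1)) 0 0 (1 / (of_nat n + u2))"

lemma B_Binv: "B n ** Binv n = mat 1" "Binv n ** B n = mat 1"
  using u1_nz [of n] u2_nz [of n] by (simp_all add: B_def Binv_def mat2_simps mat_nth)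

definition Q :: "nat \<Rightarrow> mpoly2" where
  "Q n = mat (q n)"

definition P :: "nat \<Rightarrow> mpoly2" where
  "P n = mpoly_const (Binv n) ** (Q n \<cdot>\<^sub>D V)"

text \<open>The two diagonal entries of \<open>V N\<close>, and hence of \<open>A n ** B n\<close>, as polynomials in the eigenvalue of
\<open>delta\<close>.\<close>

definition M1 :: "complex poly" where "M1 = [:- (u1 * (u2 + 1)), -1:]"
definition M2 :: "complex poly" where "M2 = [:- (u2 * (u1 + 1)), -1:]"

lemma A_times_B: "A n ** B n = mat2 (poly M1 (lam n)) 0 0 (poly M2 (lam n))"
  "B n ** A n = mat2 (poly M1 (lam n)) 0 0 (poly M2 (lam n))"
  by (simp_all add: A_def B_def M1_def M2_def lam_def mat2_simps algebra_simps)

lemma Q_monic: "mpoly_monic n (Q n)"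
  by (simp add: mpoly_monic_def mpoly_coeff_def Q_def vec_eq_iff mat_nth coeff_q coeff_eq_0 degree_q)

lemma Q_V: "Q n \<cdot>\<^sub>D V = mpoly_const (B n) ** P n"
  by (simp add: P_def matrix_mul_assoc B_Binv mpoly_const_mat flip: mpoly_const_mult one_pCons)

text \<open>Applying \<open>N\<close> to \<open>q n I \<cdot> V\<close> gives \<open>V N\<close> on an eigenfunction of \<open>delta\<close>, and the factor \<open>B n\<close> of the
diagonal eigenvalue \<open>A n ** B n\<close> cancels against \<open>P n = B n\<^sup>-\<^sup>1 (q n I \<cdot> V)\<close>.\<close>

lemma P_N: "P n \<cdot>\<^sub>D N = mpoly_const (A n) ** Q n"
proof -
  have "Q n \<cdot>\<^sub>D V \<cdot>\<^sub>D N = mpoly_const (A n ** B n) ** Q n"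
    unfolding A_times_B(1)
    unfolding Q_def act_V_N delta_q vec_eq_iff forall_2 matrix_matrix_mult_def
    by (simp add: sum_2 mat_nth M1_def M2_def) (intro conjI poly_ext; simp add: algebra_simps)
  also have "A n ** B n = B n ** A n"
    by (simp add: A_times_B)
  finally show ?thesis
    by (simp add: P_def op_act_const_left matrix_mul_assoc B_Binv flip: mpoly_const_mult)
qed

lemma P_monic: "mpoly_monic n (P n)"
proof -
  have "coeff (pderiv (q n)) m = (if Suc m = n then of_nat n else 0)" if "m \<ge> n" for m
    using that by (simp add: coeff_pderiv coeff_eq_0 degree_q)
  moreover have "coeff ([:z, 1:] * pderiv (q n)) m = (if m = n then of_nat n else 0)"
    if "m \<ge> n" for m z
    using that by (cases m) (auto simp: coeff_pCons coeff_pderiv coeff_eq_0 degree_q coeff_q)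
  ultimately have "mpoly_coeff (Q n \<cdot>\<^sub>D V) m = (if m = n then B n else 0)" if "m \<ge> n" for m
    using that
    by (simp add: Q_def act_V mpoly_coeff_def mat2_simps B_def coeff_q coeff_eq_0 degree_q)
  then show ?thesis
    by (simp add: mpoly_monic_def P_def mpoly_coeff_const_mult B_Binv)
qed

end

section \<open>Spans and polynomials in the index\<close>

lemma poly_eq_if_eq_on_nat:
  fixes p r :: "complex poly"
  assumes "\<And>n. poly p (of_nat n) = poly r (of_nat n)"
  shows "p = r"
proof -
  have "\<not> finite {z. poly (p - r) z = 0}"
  proof
    assume "finite {z. poly (p - r) z = 0}"
    moreover have "range (of_nat :: nat \<Rightarrow> complex) \<subseteq> {z. poly (p - r) z = 0}"
      using assms by auto
    ultimately have "finite (range (of_nat :: nat \<Rightarrow> complex))"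
      by (rule finite_subset [rotated])
    then show False
      by (simp add: finite_image_iff)
  qed
  then have "p - r = 0"
    using poly_roots_finite by blast
  then show ?thesis by simp
qed

text \<open>Division with remainder by a quadratic \<open>m\<close>, the remainder being expressed in the basis \<open>1, l\<close> of
the polynomials of degree at most one.\<close>

lemma linear_remainder:
  assumes "degree m = 2" "degree (l :: complex poly) = 1"
  shows "\<exists>y c0 c1. x = [:c0:] + y * m + smult c1 l"
proof -
  have m: "m \<noteq> 0" using assms by auto
  let ?r = "x mod m" and ?y = "x div m"
  have deg: "degree ?r \<le> 1"
    using degree_mod_less [OF m, of x] assms by auto
  define c1 where "c1 = coeff ?r 1 / coeff l 1"
  have "coeff l 1 \<noteq> 0"
    using assms by (metis leading_coeff_0_iff degree_0 zero_neq_one)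
  then have "coeff (?r - smult c1 l) i = 0" if "i > 0" for i
    using that deg assms(2) by (cases "i = 1") (simp_all add: c1_def coeff_eq_0)
  then have "degree (?r - smult c1 l) = 0"
    using degree_le [of 0 "?r - smult c1 l"] by simp
  then obtain c0 where "?r - smult c1 l = [:c0:]"
    using degree_eq_zeroE by blast
  then have "x = [:c0:] + ?y * m + smult c1 l"
    using div_mult_mod_eq [of x m] by (simp add: algebra_simps)
  then show ?thesis by blast
qed

definition poly_eval :: "mpoly2 \<Rightarrow> complex \<Rightarrow> complex^2^2" where
  "poly_eval X z = (\<chi> i j. poly (X $ i $ j) z)"

lemma poly_eval_nth [simp]: "poly_eval X z $ i $ j = poly (X $ i $ j) z"
  by (simp add: poly_eval_def)

text \<open>The falling factorial \<open>n (n - 1) \<cdots> (n - k + 1)\<close> as a polynomial in \<open>n\<close>.\<close>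

definition falling :: "nat \<Rightarrow> complex poly" where
  "falling k = (\<Prod>l<k. [:- of_nat l, 1:])"

lemma poly_falling: "poly (falling k) (of_nat n) = (\<Prod>l<k. of_nat n - of_nat l)"
  by (simp add: falling_def poly_prod)

lemma poly_falling_above: "n < k \<Longrightarrow> poly (falling k) (of_nat n) = 0"
  by (auto simp: poly_falling)

lemma higher_pderiv_monom_falling:
  "(pderiv ^^ k) (monom 1 n) = smult (poly (falling k) (of_nat n)) (monom 1 (n - k))"
proof (cases "k \<le> n")
  case True
  then show ?thesis
  proof (induction k)
    case (Suc k)
    then have "pderiv (monom 1 (n - k)) = smult (of_nat n - of_nat k) (monom (1 :: complex) (n - Suc k))"
      by (simp add: pderiv_monom smult_monom of_nat_diff)
    with Suc show ?case
      by (simp add: pderiv_smult poly_falling)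
  qed (simp add: falling_def)
next
  case False
  then show ?thesis
    by (simp add: higher_pderiv_monom_above poly_falling_above)
qed

lemma op_module_span_mult:
  assumes "r \<in> R" "s \<in> S"
  shows "r \<otimes>\<^sub>D s \<in> op_module_span R S"
  unfolding op_module_span_def
  using assms by (intro CollectI exI [where x = "{s}"] exI [where x = "\<lambda>_. r"]) auto

text \<open>Two combinations over different finite sets of generators are first written over their union,
with coefficients extended by zero.\<close>

lemma op_module_span_add:
  assumes "0 \<in> R" and "\<And>r r'. r \<in> R \<Longrightarrow> r' \<in> R \<Longrightarrow> r + r' \<in> R"
    and "x \<in> op_module_span R S" "y \<in> op_module_span R S"
  shows "x + y \<in> op_module_span R S"
proof -
  from assms(3) obtain T r where x: "x = (\<Sum>s\<in>T. r s \<otimes>\<^sub>D s)" "finite T" "T \<subseteq> S" "r ` T \<subseteq> R"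
    by (auto simp: op_module_span_def)
  from assms(4) obtain T' r' where y: "y = (\<Sum>s\<in>T'. r' s \<otimes>\<^sub>D s)" "finite T'" "T' \<subseteq> S" "r' ` T' \<subseteq> R"
    by (auto simp: op_module_span_def)
  define t where "t = (\<lambda>s. if s \<in> T then r s else 0)"
  define t' where "t' = (\<lambda>s. if s \<in> T' then r' s else 0)"
  have "x = (\<Sum>s\<in>T \<union> T'. t s \<otimes>\<^sub>D s)"
    unfolding x(1) using x(2) y(2) by (intro sum.mono_neutral_cong_left) (auto simp: t_def)
  moreover have "y = (\<Sum>s\<in>T \<union> T'. t' s \<otimes>\<^sub>D s)"
    unfolding y(1) using x(2) y(2) by (intro sum.mono_neutral_cong_left) (auto simp: t'_def)
  ultimately have "x + y = (\<Sum>s\<in>T \<union> T'. (t s + t' s) \<otimes>\<^sub>D s)"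
    by (simp add: op_mult_add_left sum.distrib)
  moreover have "(\<lambda>s. t s + t' s) ` (T \<union> T') \<subseteq> R"
    using x(4) y(4) assms(1,2) by (auto simp: t_def t'_def image_subset_iff)
  ultimately show ?thesis
    using x(2,3) y(2,3) unfolding op_module_span_def
    by (intro CollectI exI [where x = "T \<union> T'"] exI [where x = "\<lambda>s. t s + t' s"]) auto
qed

section \<open>Eigenvalue sequences\<close>

context jacobi_darboux
begin

definition eig :: "diffop \<Rightarrow> (nat \<Rightarrow> complex^2^2) \<Rightarrow> bool" where
  "eig D \<Lambda> \<longleftrightarrow> (\<forall>n. P n \<cdot>\<^sub>D D = mpoly_const (\<Lambda> n) ** P n)"

definition alg :: "diffop set" where
  "alg = {D. \<forall>n. \<exists>\<Lambda>. P n \<cdot>\<^sub>D D = mpoly_const \<Lambda> ** P n}"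

lemma alg_iff: "D \<in> alg \<longleftrightarrow> (\<exists>\<Lambda>. eig D \<Lambda>)"
  by (simp add: alg_def eig_def) (rule choice_iff)

lemma alg_if_eig: "eig D \<Lambda> \<Longrightarrow> D \<in> alg"
  by (auto simp: alg_iff)

lemma op_eq_if_eig: "eig D \<Lambda> \<Longrightarrow> eig E \<Lambda> \<Longrightarrow> D = E"
  by (rule op_eq_if_basis_act [OF P_monic]) (simp add: eig_def)

lemma eig_add: "eig D \<Lambda> \<Longrightarrow> eig E M \<Longrightarrow> eig (D + E) (\<lambda>n. \<Lambda> n + M n)"
  by (simp add: eig_def op_act_add mpoly_const_add_mult)

lemma eig_diff: "eig D \<Lambda> \<Longrightarrow> eig E M \<Longrightarrow> eig (D - E) (\<lambda>n. \<Lambda> n - M n)"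
  by (simp add: eig_def op_act_diff mpoly_const_diff_mult)

lemma eig_mult: "eig D \<Lambda> \<Longrightarrow> eig E M \<Longrightarrow> eig (D \<otimes>\<^sub>D E) (\<lambda>n. \<Lambda> n ** M n)"
  by (simp add: eig_def op_act_mult op_act_const_left mpoly_const_mult matrix_mul_assoc)

lemma eig_scalar: "eig [:mat [:k:]:] (\<lambda>n. mat k)"
  by (simp add: eig_def op_act_pCons_0 mpoly_const_mat mat_commute)

lemma eig_one: "eig op_one (\<lambda>n. mat 1)"
  using eig_scalar [of 1] by (simp add: op_one_def one_pCons)

lemma eig_zero: "eig 0 (\<lambda>n. 0)"
  by (simp add: eig_def vec_eq_iff matrix_matrix_mult_def)

lemma op_delta_exists: "\<exists>D. \<forall>f. mat f \<cdot>\<^sub>D D = mat (delta f)"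
proof
  let ?D = "[:0, mat [:- a * (u1 - u2), u1 + u2 + 2:], mat [:-1, 0, 1:]:] :: diffop"
  show "\<forall>f. mat f \<cdot>\<^sub>D ?D = mat (delta f)"
  proof
    fix f
    have "mat f \<cdot>\<^sub>D ?D = (\<Sum>j\<le>2. mat ((pderiv ^^ j) f) ** coeff ?D j)"
      by (simp add: op_act_eq_sum [where n = 2] mpoly_deriv_pow_mat)
    also have "\<dots> = mat (delta f)"
      by (simp add: numeral_2_eq_2 vec_eq_iff mat_mult_nth mat_nth delta_def)
    finally show "mat f \<cdot>\<^sub>D ?D = mat (delta f)" .
  qed
qed

text \<open>The operator \<open>x(\<delta>)\<close> for a polynomial \<open>x\<close>, built by Horner's scheme.\<close>

lemma scalar_function_op_exists:
  "\<exists>T. \<forall>n. Q n \<cdot>\<^sub>D T = mat [:poly x (lam n):] ** Q n"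
proof (induction x rule: pCons_induct)
  case 0
  show ?case by (rule exI [of _ 0]) (simp add: vec_eq_iff mat_mult_nth)
next
  case (pCons k x)
  obtain T where T: "\<And>n. Q n \<cdot>\<^sub>D T = mat [:poly x (lam n):] ** Q n"
    using pCons.IH by blast
  obtain D where D: "\<And>f. mat f \<cdot>\<^sub>D D = mat (delta f)"
    using op_delta_exists by blast
  have QD: "Q n \<cdot>\<^sub>D D = mpoly_const (mat (lam n)) ** Q n" for n
    by (simp add: Q_def D delta_q mpoly_const_mat vec_eq_iff mat_mult_nth mat_nth)
  have "Q n \<cdot>\<^sub>D ([:mat [:k:]:] + D \<otimes>\<^sub>D T) = mat [:poly (pCons k x) (lam n):] ** Q n" for n
    unfolding op_act_add op_act_mult QD op_act_const_left T op_act_pCons_0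
    by (simp add: mpoly_const_mat vec_eq_iff mat_mult_nth mat_commute smult_add_left mult.commute)
  then show ?case by blast
qed

lemma matrix_function_op_exists:
  "\<exists>T. \<forall>n. Q n \<cdot>\<^sub>D T = mpoly_const (poly_eval X (lam n)) ** Q n"
proof -
  define T where "T i j = (SOME T. \<forall>n. Q n \<cdot>\<^sub>D T = mat [:poly (X $ i $ j) (lam n):] ** Q n)" for i j
  have T: "Q n \<cdot>\<^sub>D T i j = mat [:poly (X $ i $ j) (lam n):] ** Q n" for i j n
    using someI_ex [OF scalar_function_op_exists [of "X $ i $ j"]] by (simp add: T_def)
  let ?T = "T 1 1 \<otimes>\<^sub>D [:mat2 1 0 0 0:] + T 1 2 \<otimes>\<^sub>D [:mat2 0 1 0 0:] +
    T 2 1 \<otimes>\<^sub>D [:mat2 0 0 1 0:] + T 2 2 \<otimes>\<^sub>D [:mat2 0 0 0 1:]"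
  have "Q n \<cdot>\<^sub>D ?T = mpoly_const (poly_eval X (lam n)) ** Q n" for n
    unfolding op_act_add op_act_mult T op_act_pCons_0
    by (simp add: mat2_simps Q_def mat_nth)
  then show ?thesis by blast
qed

text \<open>The path \<open>P n \<mapsto> A n q n \<mapsto> A n X n q n \<mapsto> A n X n B n P n\<close>: go down to the scalar Jacobi
polynomials with \<open>N\<close>, act diagonally there, and return with \<open>V\<close>.\<close>

lemma eig_sandwich:
  assumes "\<And>n. Q n \<cdot>\<^sub>D T = mpoly_const (X n) ** Q n"
  shows "eig (N \<otimes>\<^sub>D T \<otimes>\<^sub>D V) (\<lambda>n. A n ** X n ** B n)"
  unfolding eig_def
  by (simp add: op_act_mult P_N op_act_const_left assms Q_V matrix_mul_assoc flip: mpoly_const_mult)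

lemma eig_sandwich_const: "eig (N \<otimes>\<^sub>D [:mpoly_const E:] \<otimes>\<^sub>D V) (\<lambda>n. A n ** E ** B n)"
  by (rule eig_sandwich) (simp add: op_act_pCons_0 Q_def mat_commute)

lemma sandwich_exists: "\<exists>D. eig D (\<lambda>n. A n ** poly_eval X (lam n) ** B n)"
proof -
  obtain T where "\<And>n. Q n \<cdot>\<^sub>D T = mpoly_const (poly_eval X (lam n)) ** Q n"
    using matrix_function_op_exists by blast
  from eig_sandwich [OF this] show ?thesis by blast
qed

text \<open>Modulo polynomials of degree below \<open>n\<close>, which operators of the algebra preserve, \<open>x\<^sup>n I\<close> and
\<open>P n\<close> agree.\<close>

lemma eig_leading_coeff:
  assumes "eig D \<Lambda>"
  shows "\<Lambda> n = mpoly_coeff (mat (monom 1 n) \<cdot>\<^sub>D D) n"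
proof -
  have "mpoly_coeff (mat (monom 1 n) - P n) m = 0" if "m \<ge> n" for m
  proof -
    have "mpoly_coeff (mat (monom 1 n)) m = (if m = n then mat 1 else 0)"
      by (auto simp: mpoly_coeff_def vec_eq_iff mat_nth)
    with that show ?thesis
      using P_monic [of n] by (auto simp: mpoly_coeff_diff mpoly_monic_def)
  qed
  then obtain C where "mat (monom 1 n) - P n = (\<Sum>m<n. mpoly_const (C m) ** P m)"
    using monic_expansion [of P, OF P_monic] by blast
  then have "mat (monom 1 n) = P n + (\<Sum>m<n. mpoly_const (C m) ** P m)"
    by (simp add: algebra_simps)
  then have "mat (monom 1 n) \<cdot>\<^sub>D D =
      mpoly_const (\<Lambda> n) ** P n + (\<Sum>m<n. mpoly_const (C m ** \<Lambda> m) ** P m)"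
    using assms by (simp add: eig_def op_act_add_left op_act_sum_left op_act_const_left
        mpoly_const_mult matrix_mul_assoc)
  then show ?thesis
    by (simp add: mpoly_coeff_add mpoly_coeff_sum mpoly_coeff_const_mult
        mpoly_monic_coeff [OF P_monic])
qed

lemma eig_polynomial_in_n:
  assumes "eig D \<Lambda>"
  shows "\<exists>p. \<forall>n. \<Lambda> n $ i $ j = poly p (of_nat n)"
proof (intro exI allI)
  fix n
  let ?F = "\<lambda>k. coeff D k $ i $ j"
  have *: "coeff ((pderiv ^^ k) (monom 1 n) * F) n = poly (falling k) (of_nat n) * coeff F k" for k F
  proof (cases "k \<le> n")
    case True
    then show ?thesis
      by (simp add: higher_pderiv_monom_falling coeff_monom_mult)
  qed (simp add: higher_pderiv_monom_above poly_falling_above)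
  have "(mat (monom 1 n) \<cdot>\<^sub>D D) $ i $ j = (\<Sum>k\<le>degree D. (pderiv ^^ k) (monom 1 n) * ?F k)"
    by (simp add: op_act_def mpoly_deriv_pow_mat mat_mult_nth)
  then have "\<Lambda> n $ i $ j = (\<Sum>k\<le>degree D. poly (falling k) (of_nat n) * coeff (?F k) k)"
    by (simp add: eig_leading_coeff [OF assms] mpoly_coeff_def coeff_sum *)
  then show "\<Lambda> n $ i $ j = poly (\<Sum>k\<le>degree D. smult (coeff (?F k) k) (falling k)) (of_nat n)"
    by (simp add: poly_sum mult.commute)
qed

text \<open>Evaluating \<open>q n I \<cdot> T = \<Gamma> n q n\<close> at the point \<open>1\<close> and dividing by \<open>q n (1)\<close> expresses \<open>\<Gamma> n\<close> through the
Taylor coefficients of the Jacobi polynomials there. The order of \<open>T\<close> bounds the number of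
terms, so a single polynomial serves for all \<open>n\<close>.\<close>

lemma diagonal_on_Q_polynomial_in_lam:
  assumes "\<And>n. Q n \<cdot>\<^sub>D T = mpoly_const (\<Gamma> n) ** Q n"
  shows "\<exists>G. \<forall>n. \<Gamma> n = poly_eval G (lam n)"
proof (intro exI allI)
  fix n
  let ?F = "\<lambda>i j k. poly (coeff T k $ i $ j) 1"
  let ?G = "\<chi> i j. \<Sum>k\<le>degree T. smult ((-1) ^ k * fact k * ?F i j k) (jac_coeff k)"
  let ?\<kappa> = "1 / lead_coeff (jac n)"
  have "\<Gamma> n $ i $ j = poly_eval ?G (lam n) $ i $ j" for i j
  proof -
    have q: "poly ((pderiv ^^ k) (q n)) 1 = ?\<kappa> * ((-1) ^ k * fact k * poly (jac_coeff k) (lam n))" for k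
      by (simp add: q_def higher_pderiv_smult higher_pderiv_jac_at_1)
    have "(\<Sum>k\<le>degree T. (pderiv ^^ k) (q n) * coeff T k $ i $ j) = (Q n \<cdot>\<^sub>D T) $ i $ j"
      by (simp add: op_act_def Q_def mpoly_deriv_pow_mat mat_mult_nth)
    also have "\<dots> = smult (\<Gamma> n $ i $ j) (q n)"
      by (simp add: assms) (simp add: Q_def mat_commute mat_mult_nth)
    finally have "poly (\<Sum>k\<le>degree T. (pderiv ^^ k) (q n) * coeff T k $ i $ j) 1 =
        poly (smult (\<Gamma> n $ i $ j) (q n)) 1"
      by simp
    then have "?\<kappa> * (\<Sum>k\<le>degree T. (-1) ^ k * fact k * ?F i j k * poly (jac_coeff k) (lam n)) =
        ?\<kappa> * \<Gamma> n $ i $ j"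
      using q [of 0] by (simp add: poly_sum q sum_distrib_left jac_coeff_def mult_ac)
    then show ?thesis
      using lead_coeff_jac_nz [of n] by (simp add: poly_sum)
  qed
  then show "\<Gamma> n = poly_eval ?G (lam n)"
    by (simp add: vec_eq_iff)
qed

lemma intertwined_polynomial_in_lam:
  assumes "eig D \<Lambda>"
  shows "\<exists>G. \<forall>n. B n ** \<Lambda> n ** A n = poly_eval G (lam n)"
proof (rule diagonal_on_Q_polynomial_in_lam)
  fix n
  show "Q n \<cdot>\<^sub>D (V \<otimes>\<^sub>D D \<otimes>\<^sub>D N) = mpoly_const (B n ** \<Lambda> n ** A n) ** Q n"
    using assms by (simp add: eig_def op_act_mult Q_V op_act_const_left P_N matrix_mul_assoc
        flip: mpoly_const_mult)
qed

text \<open>Both sides are polynomials in \<open>n\<close> and agree for every complex argument in place of \<open>n\<close>; at \<open>- r\<close>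
and \<open>- s\<close> the left side vanishes, and the right side is \<open>G\<close> at the value of the quadratic
polynomial \<open>z (z + u1 + u2 + 1)\<close>.\<close>

lemma vanishes_at_reflected_roots:
  assumes "\<And>n. (of_nat n + r) * poly p (of_nat n) * (of_nat n + s) = poly G (lam n)"
  shows "poly G (- r * (u1 + u2 + 1 - r)) = 0" "poly G (- s * (u1 + u2 + 1 - s)) = 0"
proof -
  let ?l = "[:0, u1 + u2 + 1, 1:]"
  have "[:r, 1:] * p * [:s, 1:] = G \<circ>\<^sub>p ?l"
  proof (rule poly_eq_if_eq_on_nat)
    fix n
    show "poly ([:r, 1:] * p * [:s, 1:]) (of_nat n) = poly (G \<circ>\<^sub>p ?l) (of_nat n)"
      using assms [of n] by (simp add: poly_pcompose lam_def algebra_simps)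
  qed
  moreover have "poly ([:r, 1:] * p * [:s, 1:]) z = (z + r) * poly p z * (z + s)" for z
    by (simp add: algebra_simps)
  ultimately have *: "poly G (poly ?l z) = (z + r) * poly p z * (z + s)" for z
    by (metis poly_pcompose)
  have "poly ?l (- r) = - r * (u1 + u2 + 1 - r)" "poly ?l (- s) = - s * (u1 + u2 + 1 - s)"
    by (simp_all add: algebra_simps)
  then show "poly G (- r * (u1 + u2 + 1 - r)) = 0" "poly G (- s * (u1 + u2 + 1 - s)) = 0"
    using * [of "- r"] * [of "- s"] by simp_all
qed

section \<open>The form of the eigenvalues\<close>

text \<open>The roots of \<open>M1\<close> and \<open>M2\<close>.\<close>

definition r1 :: complex where "r1 = - (u1 * (u2 + 1))"
definition r2 :: complex where "r2 = - (u2 * (u1 + 1))"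

lemma r_neq: "r1 \<noteq> r2"
  using u_neq by (simp add: r1_def r2_def algebra_simps)

lemma M_roots: "M1 = - [:- r1, 1:]" "M2 = - [:- r2, 1:]"
  by (simp_all add: M1_def M2_def r1_def r2_def)

text \<open>The reflection \<open>z \<mapsto> - z - (u1 + u2 + 1)\<close>, which fixes \<open>z (z + u1 + u2 + 1)\<close>, exchanges \<open>- u1\<close> with
\<open>- (u2 + 1)\<close> and \<open>- u2\<close> with \<open>- (u1 + 1)\<close>. So the eight linear factors in the entries of
\<open>B n ** \<Lambda> n ** A n\<close> produce only two values.\<close>

lemma reflected_roots:
  "- u1 * (u1 + u2 + 1 - u1) = r1" "- (u2 + 1) * (u1 + u2 + 1 - (u2 + 1)) = r1"
  "- u2 * (u1 + u2 + 1 - u2) = r2" "- (u1 + 1) * (u1 + u2 + 1 - (u1 + 1)) = r2"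
  by (simp_all add: r1_def r2_def algebra_simps)

lemma shifted_nz: "of_nat n + u1 + 1 \<noteq> 0" "of_nat n + u2 + 1 \<noteq> 0"
  using u1_nz [of "Suc n"] u2_nz [of "Suc n"] by (simp_all add: add_ac)

lemma dvd_M1: "poly G r1 = 0 \<Longrightarrow> \<exists>H. G = M1 * H"
  unfolding dvd_def [symmetric] M_roots minus_dvd_iff by (simp add: poly_eq_0_iff_dvd)

lemma dvd_M2: "poly G r2 = 0 \<Longrightarrow> \<exists>H. G = M2 * H"
  unfolding dvd_def [symmetric] M_roots minus_dvd_iff by (simp add: poly_eq_0_iff_dvd)

lemma dvd_M1_M2:
  assumes "poly G r1 = 0" "poly G r2 = 0"
  shows "\<exists>H. G = M1 * M2 * H"
proof -
  obtain H where H: "G = M1 * H"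
    using dvd_M1 assms(1) by blast
  with assms(2) r_neq have "poly H r2 = 0"
    by (simp add: M_roots)
  then obtain H' where "H = M2 * H'"
    using dvd_M2 by blast
  with H show ?thesis by (auto simp: mult.assoc)
qed

lemma M_lam:
  "poly M1 (lam n) = - ((of_nat n + u1) * (of_nat n + u2 + 1))"
  "poly M2 (lam n) = - ((of_nat n + u2) * (of_nat n + u1 + 1))"
  by (simp_all add: M1_def M2_def lam_def algebra_simps)

text \<open>In a diagonal entry of \<open>B n ** \<Lambda> n ** A n\<close> both linear factors force the same root, so that one
divides by \<open>M1\<close> or \<open>M2\<close> once, and \<open>\<Lambda> n\<close> has there a polynomial in \<open>lam n\<close>, which is a
constant plus a multiple of \<open>M1\<close> or \<open>M2\<close>. In an off-diagonal entry they force both roots \<open>r1 \<noteq> r2\<close>,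
and the quotient by \<open>M1 * M2\<close> is the entry of \<open>X\<close>.\<close>

lemma eigenvalue_form:
  assumes "eig D \<Lambda>"
  shows "\<exists>k1 k2 X. \<forall>n. \<Lambda> n = mat2 k1 0 0 k2 + A n ** poly_eval X (lam n) ** B n"
proof -
  obtain G where G: "\<And>n. B n ** \<Lambda> n ** A n = poly_eval G (lam n)"
    using intertwined_polynomial_in_lam [OF assms] by blast
  have product:
    "(B n ** \<Lambda> n ** A n) $ 1 $ 1 = - ((of_nat n + u1) * \<Lambda> n $ 1 $ 1 * (of_nat n + (u2 + 1)))"
    "(B n ** \<Lambda> n ** A n) $ 1 $ 2 = - ((of_nat n + u1) * \<Lambda> n $ 1 $ 2 * (of_nat n + (u1 + 1)))"
    "(B n ** \<Lambda> n ** A n) $ 2 $ 1 = - ((of_nat n + u2) * \<Lambda> n $ 2 $ 1 * (of_nat n + (u2 + 1)))"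
    "(B n ** \<Lambda> n ** A n) $ 2 $ 2 = - ((of_nat n + u2) * \<Lambda> n $ 2 $ 2 * (of_nat n + (u1 + 1)))" for n
    by (simp_all add: matrix_matrix_mult_def sum_2 A_def B_def algebra_simps)
  have entries:
    "(of_nat n + u1) * \<Lambda> n $ 1 $ 1 * (of_nat n + (u2 + 1)) = poly (- (G $ 1 $ 1)) (lam n)"
    "(of_nat n + u1) * \<Lambda> n $ 1 $ 2 * (of_nat n + (u1 + 1)) = poly (- (G $ 1 $ 2)) (lam n)"
    "(of_nat n + u2) * \<Lambda> n $ 2 $ 1 * (of_nat n + (u2 + 1)) = poly (- (G $ 2 $ 1)) (lam n)"
    "(of_nat n + u2) * \<Lambda> n $ 2 $ 2 * (of_nat n + (u1 + 1)) = poly (- (G $ 2 $ 2)) (lam n)" for n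
    using product [of n] by (simp_all add: G)
  have roots: "poly (- G') (- r * (u1 + u2 + 1 - r)) = 0 \<and> poly (- G') (- s * (u1 + u2 + 1 - s)) = 0"
    if "\<And>n. (of_nat n + r) * \<Lambda> n $ i $ j * (of_nat n + s) = poly (- G') (lam n)" for i j G' r s
  proof -
    obtain p where "\<And>n. \<Lambda> n $ i $ j = poly p (of_nat n)"
      using eig_polynomial_in_n [OF assms] by blast
    with that vanishes_at_reflected_roots [of r p s "- G'"] show ?thesis by metis
  qed
  have "poly (G $ 1 $ 1) r1 = 0" "poly (G $ 1 $ 2) r1 = 0" "poly (G $ 1 $ 2) r2 = 0"
    "poly (G $ 2 $ 1) r1 = 0" "poly (G $ 2 $ 1) r2 = 0" "poly (G $ 2 $ 2) r2 = 0"
    using roots [OF entries(1)] roots [OF entries(2)] roots [OF entries(3)] roots [OF entries(4)]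
    unfolding reflected_roots by simp_all
  from dvd_M1 [OF this(1)] dvd_M1_M2 [OF this(2,3)] dvd_M1_M2 [OF this(4,5)] dvd_M2 [OF this(6)]
  obtain H11 H12 H21 H22 where H: "G $ 1 $ 1 = M1 * H11" "G $ 1 $ 2 = M1 * M2 * H12"
    "G $ 2 $ 1 = M1 * M2 * H21" "G $ 2 $ 2 = M2 * H22"
    by blast
  have "poly (H11 - [:poly H11 r1:]) r1 = 0" "poly (H22 - [:poly H22 r2:]) r2 = 0"
    by simp_all
  from dvd_M1 [OF this(1)] dvd_M2 [OF this(2)]
  obtain X11 X22 where X: "H11 - [:poly H11 r1:] = M1 * X11" "H22 - [:poly H22 r2:] = M2 * X22"
    by blast
  let ?k1 = "poly H11 r1" and ?k2 = "poly H22 r2"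
  let ?X = "mat2 X11 H12 H21 X22"
  have H11: "poly H11 z = ?k1 + poly M1 z * poly X11 z" for z
    using arg_cong [OF X(1), of "\<lambda>p. poly p z"] by (simp add: algebra_simps)
  have H22: "poly H22 z = ?k2 + poly M2 z * poly X22 z" for z
    using arg_cong [OF X(2), of "\<lambda>p. poly p z"] by (simp add: algebra_simps)
  have "\<Lambda> n = mat2 ?k1 0 0 ?k2 + A n ** poly_eval ?X (lam n) ** B n" for n
  proof -
    let ?l = "lam n"
    have nz: "of_nat n + u1 \<noteq> 0" "of_nat n + u2 \<noteq> 0" "of_nat n + (u1 + 1) \<noteq> 0" "of_nat n + (u2 + 1) \<noteq> 0"
      using u1_nz [of n] u2_nz [of n] shifted_nz [of n] by (simp_all add: add_ac)
    have cancel: "y = y'" if "r * y * s = r * y' * s" "r \<noteq> 0" "s \<noteq> 0" for y y' r s :: complex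
      using that by simp
    have "\<Lambda> n $ 1 $ 1 = poly H11 ?l"
      by (rule cancel [OF trans [OF entries(1)] nz(1) nz(4)]) (simp add: H M_lam add_ac mult_ac)
    moreover have "\<Lambda> n $ 2 $ 2 = poly H22 ?l"
      by (rule cancel [OF trans [OF entries(4)] nz(2) nz(3)]) (simp add: H M_lam add_ac mult_ac)
    moreover have "\<Lambda> n $ 1 $ 2 = - ((of_nat n + u2 + 1) * poly H12 ?l * (of_nat n + u2))"
      by (rule cancel [OF trans [OF entries(2)] nz(1) nz(3)]) (simp add: H M_lam add_ac mult_ac)
    moreover have "\<Lambda> n $ 2 $ 1 = - ((of_nat n + u1 + 1) * poly H21 ?l * (of_nat n + u1))"
      by (rule cancel [OF trans [OF entries(3)] nz(2) nz(4)]) (simp add: H M_lam add_ac mult_ac)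
    ultimately show ?thesis
      unfolding H11 [of ?l] H22 [of ?l] M_lam by (simp add: mat2_simps A_def B_def algebra_simps)
  qed
  then show ?thesis by blast
qed

text \<open>With \<open>K = diag(k1, k2)\<close>, which commutes with \<open>B n\<close>, one gets \<open>V D = K V\<close> as operators. The right side
has order one, and \<open>V\<close> has order one with a leading coefficient that is not a zero divisor, so \<open>D\<close>
has order zero. Comparing both sides on \<open>q 0\<close> and \<open>q 1\<close> gives \<open>D = K\<close> in the second column
and then \<open>(1 + a) k2 = k1 (1 + a)\<close>.\<close>

lemma diagonal_eigenvalue_is_scalar:
  assumes "eig D (\<lambda>n. mat2 k1 0 0 k2)"
  shows "k1 = k2"
proof -
  let ?K = "mpoly_const (mat2 k1 0 0 k2)"
  let ?V0 = "mat2 [:u1:] 0 0 [:u2:]" and ?V1 = "mat2 [:a, 1:] [:1 + a:] [:1 - a:] [:-a, 1:]"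
  let ?E = "[:?K ** ?V0, ?K ** ?V1:]"
  have degV: "degree V = 1" "coeff V (Suc 0) = ?V1"
    by (auto simp: V_def vec_eq_iff forall_2)
  have VD: "V \<otimes>\<^sub>D D = ?E"
  proof (rule op_eq_if_basis_act [OF Q_monic])
    fix n
    have "Q n \<cdot>\<^sub>D (V \<otimes>\<^sub>D D) = mpoly_const (B n ** mat2 k1 0 0 k2) ** P n"
      using assms by (simp add: op_act_mult Q_V op_act_const_left eig_def mpoly_const_mult matrix_mul_assoc)
    also have "B n ** mat2 k1 0 0 k2 = mat2 k1 0 0 k2 ** B n"
      by (simp add: B_def mat2_simps)
    also have "mpoly_const \<dots> ** P n = ?K ** (Q n \<cdot>\<^sub>D V)"
      by (simp add: Q_V mpoly_const_mult matrix_mul_assoc)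
    also have "\<dots> = Q n \<cdot>\<^sub>D ?E"
      unfolding V_def op_act_first_order
      by (simp add: Q_def mpoly_deriv_def mat_nth mat2_simps algebra_simps smult_add_right)
    finally show "Q n \<cdot>\<^sub>D (V \<otimes>\<^sub>D D) = Q n \<cdot>\<^sub>D ?E" .
  qed
  \<comment> \<open>Otherwise the order of \<open>V D\<close> would exceed one.\<close>
  have "degree D = 0"
  proof (rule ccontr)
    assume d: "degree D \<noteq> 0"
    then have "coeff ?E (1 + degree D) = 0"
      by (simp add: coeff_pCons split: nat.splits)
    then have "?V1 ** coeff D (degree D) = 0"
      using coeff_op_mult_top [of V D] by (simp add: VD degV)
    then have "mat [:1, 0, -1:] ** coeff D (degree D) = 0"
      unfolding V_factor(2) [symmetric] by (simp flip: matrix_mul_assoc)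
    from arg_cong [OF this, of "\<lambda>M. M $ i $ j" for i j]
    have "[:1, 0, -1:] * coeff D (degree D) $ i $ j = 0" for i j
      by (simp only: mat_mult_nth zero_index)
    then have "coeff D (degree D) = 0"
      by (simp only: mult_eq_0_iff vec_eq_iff) simp
    with d show False by simp
  qed
  then obtain F where F: "D = [:F:]"
    using degree_eq_zeroE by blast
  have act: "(mat (q n) \<cdot>\<^sub>D V) ** F = ?K ** (mat (q n) \<cdot>\<^sub>D V)" for n
  proof -
    have "Q n \<cdot>\<^sub>D V \<cdot>\<^sub>D D = mpoly_const (B n ** mat2 k1 0 0 k2) ** P n"
      using assms by (simp add: Q_V op_act_const_left eig_def mpoly_const_mult matrix_mul_assoc)
    also have "B n ** mat2 k1 0 0 k2 = mat2 k1 0 0 k2 ** B n"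
      by (simp add: B_def mat2_simps)
    also have "mpoly_const \<dots> ** P n = ?K ** (Q n \<cdot>\<^sub>D V)"
      by (simp add: Q_V mpoly_const_mult matrix_mul_assoc)
    finally show ?thesis
      by (simp only: Q_def F op_act_pCons_0)
  qed
  have q0: "q 0 = 1"
    using degree_q [of 0] coeff_q [of 0] by (auto elim!: degree_eq_zeroE simp: one_pCons)
  obtain z y where zy: "q 1 = [:z, y:]"
    using degree_q [of 1] by (rule degree1_coeffs)
  moreover have "coeff (q 1) 1 = 1"
    by (rule coeff_q)
  ultimately have q1: "q 1 = [:z, 1:]"
    by (simp only: coeff_pCons_Suc coeff_pCons_0 One_nat_def)
  have "u1 \<noteq> 0" "u2 \<noteq> 0"
    using u1_nz [of 0] u2_nz [of 0] by simp_all
  then have F0: "F $ 1 $ 2 = 0" "smult u2 (F $ 2 $ 2) = smult (k2 * u2) 1"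
    using act [of 0] by (simp_all add: q0 act_V mat2_simps flip: smult_one)
  from arg_cong [OF F0(2), of "smult (1 / u2)"] have "F $ 2 $ 2 = [:k2:]"
    using \<open>u2 \<noteq> 0\<close> by simp
  note F1 = F0(1) this
  have "(mat (q 1) \<cdot>\<^sub>D V ** F) $ 1 $ 2 = (?K ** (mat (q 1) \<cdot>\<^sub>D V)) $ 1 $ 2"
    by (simp only: act)
  then show "k1 = k2"
    using a_nz by (simp add: q1 [unfolded One_nat_def] act_V mat2_simps F1 pderiv_pCons)
qed

text \<open>The part \<open>A n ** X (lam n) ** B n\<close> is itself realized by an operator; subtracting it leaves an
operator with constant diagonal eigenvalue.\<close>

lemma alg_eigenvalue_form:
  assumes "eig D \<Lambda>"
  shows "\<exists>k X. \<forall>n. \<Lambda> n = mat k + A n ** poly_eval X (lam n) ** B n"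
proof -
  obtain k1 k2 X where \<Lambda>: "\<And>n. \<Lambda> n = mat2 k1 0 0 k2 + A n ** poly_eval X (lam n) ** B n"
    using eigenvalue_form [OF assms] by blast
  obtain S where "eig S (\<lambda>n. A n ** poly_eval X (lam n) ** B n)"
    using sandwich_exists by blast
  from eig_diff [OF assms this] have "eig (D - S) (\<lambda>n. mat2 k1 0 0 k2)"
    by (simp add: \<Lambda>)
  then have "k1 = k2"
    by (rule diagonal_eigenvalue_is_scalar)
  then have "mat2 k1 0 0 k2 = mat k1"
    by (simp add: vec_eq_iff forall_2 mat_nth)
  with \<Lambda> show ?thesis by auto
qed

section \<open>Generation over the center\<close>

text \<open>Scalar eigenvalues commute with everything. The multiples of \<open>M1 * M2\<close> arise as \<open>A n ** X ** B n\<close>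
for \<open>X = y diag(M2, M1)\<close>, as \<open>A n ** B n = diag(M1, M2)\<close>.\<close>

lemma center_exists:
  "\<exists>Z \<in> op_center alg. eig Z (\<lambda>n. mat (k + poly (y * M1 * M2) (lam n)))"
proof -
  obtain S where S: "eig S (\<lambda>n. A n ** poly_eval (mat2 (y * M2) 0 0 (y * M1)) (lam n) ** B n)"
    using sandwich_exists by blast
  define Z where "Z = [:mat [:k:]:] + S"
  have "mat k + A n ** poly_eval (mat2 (y * M2) 0 0 (y * M1)) (lam n) ** B n =
      mat (k + poly (y * M1 * M2) (lam n))" for n
    by (simp add: mat2_simps mat_nth A_def B_def M_lam algebra_simps)
  then have Z: "eig Z (\<lambda>n. mat (k + poly (y * M1 * M2) (lam n)))"
    using eig_add [OF eig_scalar [of k] S] by (simp add: Z_def)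
  have "Z \<otimes>\<^sub>D D = D \<otimes>\<^sub>D Z" if D: "D \<in> alg" for D
  proof -
    obtain \<Lambda> where \<Lambda>: "eig D \<Lambda>"
      using D by (auto simp: alg_iff)
    have "mat z ** L = L ** mat z" for z :: complex and L :: "complex^2^2"
      by (simp add: mat2_simps mat_nth)
    then show ?thesis
      using op_eq_if_eig [OF eig_mult [OF Z \<Lambda>]] eig_mult [OF \<Lambda> Z] by simp
  qed
  with Z show ?thesis
    by (auto simp: op_center_def intro: alg_if_eig)
qed

definition sandwich :: "complex^2^2 \<Rightarrow> diffop" where
  "sandwich E = N \<otimes>\<^sub>D [:mpoly_const E:] \<otimes>\<^sub>D V"

lemma eig_sandwich_E: "eig (sandwich E) (\<lambda>n. A n ** E ** B n)"
  unfolding sandwich_def by (rule eig_sandwich_const)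

definition generators :: "diffop set" where
  "generators = (let D1 = sandwich (mat2 1 0 0 0); D2 = sandwich (mat2 0 1 0 0);
     D3 = sandwich (mat2 0 0 1 0); D4 = sandwich (mat2 0 0 0 1); D5 = D1 + D4 in
     {op_one, D1, D2, D3, D4, D5 \<otimes>\<^sub>D D1, D5 \<otimes>\<^sub>D D2, D5 \<otimes>\<^sub>D D3, D5 \<otimes>\<^sub>D D4})"

lemma eig_D5:
  "eig (sandwich (mat2 1 0 0 0) + sandwich (mat2 0 0 0 1)) (\<lambda>n. A n ** B n)"
proof -
  have "A n ** mat2 1 0 0 0 ** B n + A n ** mat2 0 0 0 1 ** B n = A n ** B n" for n
    by (simp add: mat2_simps A_def B_def)
  then show ?thesis
    using eig_add [OF eig_sandwich_E eig_sandwich_E, of "mat2 1 0 0 0" "mat2 0 0 0 1"] by simp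
qed

lemma alg_zero: "0 \<in> alg"
  using eig_zero alg_if_eig by blast

lemma alg_add: "D \<in> alg \<Longrightarrow> E \<in> alg \<Longrightarrow> D + E \<in> alg"
  unfolding alg_iff [of D] alg_iff [of E] by (blast intro: alg_if_eig eig_add)

lemma alg_mult: "D \<in> alg \<Longrightarrow> E \<in> alg \<Longrightarrow> D \<otimes>\<^sub>D E \<in> alg"
  unfolding alg_iff [of D] alg_iff [of E] by (blast intro: alg_if_eig eig_mult)

lemma generators_subset: "generators \<subseteq> alg"
proof -
  have "sandwich E \<in> alg" for E
    using eig_sandwich_E alg_if_eig by blast
  moreover have "op_one \<in> alg"
    using eig_one alg_if_eig by blast
  ultimately show ?thesis
    by (auto simp: generators_def Let_def intro: alg_add alg_mult)
qed

abbreviation "gspan \<equiv> op_module_span (op_center alg) generators"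

lemma span_add: "D \<in> gspan \<Longrightarrow> E \<in> gspan \<Longrightarrow> D + E \<in> gspan"
proof (rule op_module_span_add)
  show "0 \<in> op_center alg"
    by (simp add: op_center_def alg_zero op_mult_zero_right)
  show "Z + Z' \<in> op_center alg" if "Z \<in> op_center alg" "Z' \<in> op_center alg" for Z Z'
    using that by (simp add: op_center_def alg_add op_mult_add_left op_mult_add_right)
qed

text \<open>Left multiplication by \<open>D5\<close> multiplies the middle factor \<open>E\<close> of a sandwich by \<open>B n ** A n\<close>, that is,
by \<open>M1\<close> or \<open>M2\<close>. Together with the central multiples of \<open>M1 * M2\<close> and the constants this yields every
polynomial multiple \<open>x (lam n)\<close> of \<open>E\<close>.\<close>

lemma entry_in_span:
  assumes "eig D5 (\<lambda>n. A n ** B n)" and "sandwich E \<in> generators" "D5 \<otimes>\<^sub>D sandwich E \<in> generators"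
    and M: "M = M1 \<or> M = M2" "\<And>n. B n ** A n ** E = mat (poly M (lam n)) ** E"
  shows "\<exists>D \<in> gspan. eig D (\<lambda>n. A n ** (mat (poly x (lam n)) ** E) ** B n)"
proof -
  have "degree (M1 * M2) = 2" "degree M = 1"
    using M(1) by (auto simp: M1_def M2_def)
  from linear_remainder [OF this, of x]
  obtain y c0 c1 where x: "x = [:c0:] + y * (M1 * M2) + smult c1 M" by blast
  obtain Z where Z: "Z \<in> op_center alg" "eig Z (\<lambda>n. mat (c0 + poly (y * M1 * M2) (lam n)))"
    using center_exists by blast
  obtain Z' where Z': "Z' \<in> op_center alg" "eig Z' (\<lambda>n. mat (c1 + poly (0 * M1 * M2) (lam n)))"
    using center_exists by blast
  let ?D = "Z \<otimes>\<^sub>D sandwich E + Z' \<otimes>\<^sub>D (D5 \<otimes>\<^sub>D sandwich E)"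
  have pull: "A n ** (mat z ** E) ** B n = mat z ** (A n ** E ** B n)" for z n
    by (simp add: mat2_simps mat_nth algebra_simps)
  have collect: "mat z ** S + mat z' ** (mat z'' ** S) = mat (z + z' * z'') ** S"
    for z z' z'' :: complex and S :: "complex^2^2"
    by (simp add: mat2_simps mat_nth algebra_simps)
  have "?D \<in> gspan"
    using Z(1) Z'(1) assms(2,3) by (intro span_add op_module_span_mult)
  moreover have "eig ?D (\<lambda>n. mat (c0 + poly (y * M1 * M2) (lam n)) ** (A n ** E ** B n) +
      mat (c1 + poly (0 * M1 * M2) (lam n)) ** (A n ** B n ** (A n ** E ** B n)))"
    by (intro eig_add eig_mult Z(2) Z'(2) assms(1) eig_sandwich_E)
  moreover have "mat (c0 + poly (y * M1 * M2) (lam n)) ** (A n ** E ** B n) +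
      mat (c1 + poly (0 * M1 * M2) (lam n)) ** (A n ** B n ** (A n ** E ** B n)) =
      A n ** (mat (poly x (lam n)) ** E) ** B n" for n
  proof -
    have "A n ** B n ** (A n ** E ** B n) = A n ** (mat (poly M (lam n)) ** E) ** B n"
      unfolding M(2) [symmetric] by (simp add: matrix_mul_assoc)
    then show ?thesis
      unfolding pull by (simp add: collect x mult.assoc)
  qed
  ultimately have "?D \<in> gspan" "eig ?D (\<lambda>n. A n ** (mat (poly x (lam n)) ** E) ** B n)"
    by simp_all
  then show ?thesis ..
qed

theorem alg_eq_span: "alg = gspan"
proof
  show "gspan \<subseteq> alg"
  proof
    fix D assume "D \<in> gspan"
    then obtain T r where D: "D = (\<Sum>s\<in>T. r s \<otimes>\<^sub>D s)" "T \<subseteq> generators" "r ` T \<subseteq> op_center alg"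
      by (auto simp: op_module_span_def)
    have "r s \<otimes>\<^sub>D s \<in> alg" if "s \<in> T" for s
      using that D(2,3) generators_subset by (intro alg_mult) (auto simp: op_center_def)
    then have "(\<Sum>s\<in>T. r s \<otimes>\<^sub>D s) \<in> alg"
      by (induction T rule: infinite_finite_induct) (auto intro: alg_zero alg_add)
    then show "D \<in> alg" by (simp add: D(1))
  qed
  show "alg \<subseteq> gspan"
  proof
    fix D assume "D \<in> alg"
    then obtain \<Lambda> where \<Lambda>: "eig D \<Lambda>"
      by (auto simp: alg_iff)
    then obtain k X where kX: "\<And>n. \<Lambda> n = mat k + A n ** poly_eval X (lam n) ** B n"
      using alg_eigenvalue_form by blast
    obtain Z where Z: "Z \<in> op_center alg" "eig Z (\<lambda>n. mat (k + poly (0 * M1 * M2) (lam n)))"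
      using center_exists by blast
    have gen: "op_one \<in> generators" by (simp add: generators_def Let_def)
    have Z1: "Z \<otimes>\<^sub>D op_one \<in> gspan" "eig (Z \<otimes>\<^sub>D op_one) (\<lambda>n. mat k)"
      using op_module_span_mult [OF Z(1) gen] eig_mult [OF Z(2) eig_one] by simp_all
    have *: "\<exists>D \<in> gspan. eig D (\<lambda>n. A n ** (mat (poly x (lam n)) ** E) ** B n)"
      if "(E, M) \<in> {(mat2 1 0 0 0, M1), (mat2 0 1 0 0, M1), (mat2 0 0 1 0, M2), (mat2 0 0 0 1, M2)}"
      for x E M
    proof (rule entry_in_span [OF eig_D5, where M = M])
      show "sandwich E \<in> generators"
        "(sandwich (mat2 1 0 0 0) + sandwich (mat2 0 0 0 1)) \<otimes>\<^sub>D sandwich E \<in> generators"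
        "M = M1 \<or> M = M2"
        using that by (auto simp: generators_def Let_def)
      show "B n ** A n ** E = mat (poly M (lam n)) ** E" for n
        using that by (auto simp: mat2_simps mat_nth A_def B_def M_lam algebra_simps)
    qed
    obtain D1 where D1: "D1 \<in> gspan"
      "eig D1 (\<lambda>n. A n ** (mat (poly (X $ 1 $ 1) (lam n)) ** mat2 1 0 0 0) ** B n)"
      using * [of "mat2 1 0 0 0" M1] by blast
    obtain D2 where D2: "D2 \<in> gspan"
      "eig D2 (\<lambda>n. A n ** (mat (poly (X $ 1 $ 2) (lam n)) ** mat2 0 1 0 0) ** B n)"
      using * [of "mat2 0 1 0 0" M1] by blast
    obtain D3 where D3: "D3 \<in> gspan"
      "eig D3 (\<lambda>n. A n ** (mat (poly (X $ 2 $ 1) (lam n)) ** mat2 0 0 1 0) ** B n)"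
      using * [of "mat2 0 0 1 0" M2] by blast
    obtain D4 where D4: "D4 \<in> gspan"
      "eig D4 (\<lambda>n. A n ** (mat (poly (X $ 2 $ 2) (lam n)) ** mat2 0 0 0 1) ** B n)"
      using * [of "mat2 0 0 0 1" M2] by blast
    have "D = Z \<otimes>\<^sub>D op_one + D1 + D2 + D3 + D4"
    proof (rule op_eq_if_eig [OF \<Lambda>])
      have "\<Lambda> = (\<lambda>n. mat k + A n ** (mat (poly (X $ 1 $ 1) (lam n)) ** mat2 1 0 0 0) ** B n +
         A n ** (mat (poly (X $ 1 $ 2) (lam n)) ** mat2 0 1 0 0) ** B n +
         A n ** (mat (poly (X $ 2 $ 1) (lam n)) ** mat2 0 0 1 0) ** B n +
         A n ** (mat (poly (X $ 2 $ 2) (lam n)) ** mat2 0 0 0 1) ** B n)"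
        by (rule ext) (simp add: kX mat2_simps mat_nth A_def B_def)
      then show "eig (Z \<otimes>\<^sub>D op_one + D1 + D2 + D3 + D4) \<Lambda>"
        by (simp only:) (intro eig_add Z1 D1 D2 D3 D4)
    qed
    then show "D \<in> gspan"
      by (simp only:) (intro span_add Z1 D1 D2 D3 D4)
  qed
qed

end

section \<open>Orthogonality from the Pearson equation\<close>

text \<open>All that is needed of the integral \<open>L f = \<integral> f(x) (1 - x)\<^sup>\<alpha> (1 + x)\<^sup>\<beta> dx\<close> for orthogonality
is linearity and the vanishing of the integral of the derivative of
\<open>f(x) (1 - x)\<^sup>\<alpha>\<^sup>+\<^sup>1 (1 + x)\<^sup>\<beta>\<^sup>+\<^sup>1\<close>, where \<open>\<beta> - \<alpha> = a (u1 - u2)\<close> and \<open>\<alpha> + \<beta> + 2 = u1 + u2\<close>.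
The functional for the exponents \<open>\<alpha> + 1, \<beta> + 1\<close> is then \<open>f \<mapsto> L ((1 - x\<^sup>2) f)\<close>.\<close>

locale jacobi_functional = jacobi_darboux u1 u2 a for u1 u2 a :: complex +
  fixes L :: "complex poly \<Rightarrow> complex"
  assumes L_add: "L (f + h) = L f + L h"
    and L_smult: "L (smult k f) = k * L f"
    and L_pearson: "L ([:1, 0, -1:] * pderiv f + [:a * (u1 - u2), - (u1 + u2):] * f) = 0"
begin

lemma L_0 [simp]: "L 0 = 0"
  using L_smult [of 0 0] by simp

lemma L_diff: "L (f - h) = L f - L h"
  using L_add [of "f - h" h] by simp

text \<open>The difference of both sides vanishes by the Pearson equation for \<open>(1 - x\<^sup>2) (f h' - f' h)\<close>, the
Lagrange bracket of the Sturm-Liouville operator \<open>delta\<close>.\<close>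

lemma L_delta_symmetric: "L ([:1, 0, -1:] * (delta f * h)) = L ([:1, 0, -1:] * (f * delta h))"
proof -
  let ?w = "[:1, 0, -1:] * (f * pderiv h - pderiv f * h)"
  have "[:1, 0, -1:] * (delta f * h) - [:1, 0, -1:] * (f * delta h) =
      [:1, 0, -1:] * pderiv ?w + [:a * (u1 - u2), - (u1 + u2):] * ?w"
    by (rule poly_ext)
      (simp add: delta_def pderiv_mult pderiv_diff pderiv_minus pderiv_add pderiv_pCons algebra_simps)
  then have "L ([:1, 0, -1:] * (delta f * h) - [:1, 0, -1:] * (f * delta h)) = 0"
    by (simp only: L_pearson)
  then show ?thesis by (simp only: L_diff) simp
qed

lemma L_q_orthogonal:
  assumes "m \<noteq> n"
  shows "L ([:1, 0, -1:] * (q n * q m)) = 0"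
proof -
  have "lam n * L ([:1, 0, -1:] * (q n * q m)) = lam m * L ([:1, 0, -1:] * (q n * q m))"
    using L_delta_symmetric [of "q n" "q m"]
    by (simp only: delta_q mult_smult_left mult_smult_right L_smult)
  then show ?thesis
    using assms lam_inj [of n m] by (simp only: mult_cancel_right) auto
qed

lemma L_q_lower_degree:
  assumes "\<And>m. m \<ge> n \<Longrightarrow> coeff r m = 0"
  shows "L ([:1, 0, -1:] * (q n * r)) = 0"
proof -
  have "L ([:1, 0, -1:] * (q n * r)) = 0" if "d \<le> n" "\<And>m. m \<ge> d \<Longrightarrow> coeff r m = 0" for d r
    using that
  proof (induction d arbitrary: r)
    case 0
    then have "r = 0" by (simp add: poly_eq_iff)
    then show ?case by simp
  next
    case (Suc d)
    define r' where "r' = r - smult (coeff r d) (q d)"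
    have "coeff r' m = 0" if "m \<ge> d" for m
      using that Suc.prems(2) [of m]
      by (cases "m = d") (simp_all add: r'_def coeff_q coeff_eq_0 degree_q)
    with Suc have r': "L ([:1, 0, -1:] * (q n * r')) = 0"
      by simp
    have "r = r' + smult (coeff r d) (q d)"
      by (simp add: r'_def)
    then have "L ([:1, 0, -1:] * (q n * r)) =
        L ([:1, 0, -1:] * (q n * r')) + coeff r d * L ([:1, 0, -1:] * (q n * q d))"
      by (metis L_add L_smult distrib_left mult_smult_right)
    then show ?case
      using Suc.prems(1) r' L_q_orthogonal [of d n] by simp
  qed
  with assms show ?thesis by blast
qed

text \<open>The entries of the diagonal matrix in the factorization \<open>N1 K N1\<^sup>T\<close> of the weight.\<close>

definition K1 :: complex where "K1 = u1 / 2 / (1 - a)"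
definition K2 :: complex where "K2 = u2 / 2 / (1 + a)"

lemma lower_degree_derivative:
  assumes "\<And>m. m \<ge> n \<Longrightarrow> coeff (h :: complex poly) m = 0" "m \<ge> n"
  shows "coeff ([:b, d:] * pderiv h) m = 0" "coeff (smult b (pderiv h)) m = 0"
  using assms by (auto simp: coeff_pderiv coeff_pCons split: nat.splits)

text \<open>Integration by parts: the Pearson equation for \<open>q n * ([:b, -1:] * h1 + smult (1 - b) h2)\<close> moves the
derivative away from \<open>q n\<close>. What remains is \<open>q n\<close> times a polynomial that turns out to be divisible by
\<open>1 - x\<^sup>2\<close>, with a quotient of degree below \<open>n\<close>. The parameters \<open>b\<close>, \<open>w1\<close>, \<open>w2\<close> stand for \<open>a\<close>, \<open>u1\<close>,
\<open>u2\<close> in the first row of the matrices and for \<open>- a\<close>, \<open>u2\<close>, \<open>u1\<close> in the second, which is the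
first one after exchanging the two coordinates.\<close>

lemma row_orthogonal:
  assumes h: "\<And>m. m \<ge> n \<Longrightarrow> coeff h1 m = 0" "\<And>m. m \<ge> n \<Longrightarrow> coeff h2 m = 0"
    and param: "b * (w1 - w2) = a * (u1 - u2)" "w1 + w2 = u1 + u2"
    and K: "k1 * (1 - b) = w1 / 2" "k2 * (1 + b) = w2 / 2"
  shows "L (smult k1 (([:1, 0, -1:] * pderiv (q n) + smult w1 ([:b, -1:] * q n)) *
        ([:b, -1:] * h1 + smult (1 - b) h2)) +
      smult k2 (smult (w1 * (1 + b)) (q n) * (smult (1 + b) h1 + [:-b, -1:] * h2))) = 0"
    (is "L ?lhs = 0")
proof -
  let ?g1 = "[:b, -1:] * h1 + smult (1 - b) h2"
  let ?r = "- smult k1 (pderiv ?g1) + smult (w2 * k1) h1"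
  have "coeff ?r m = 0" if "m \<ge> n" for m
  proof -
    have "pderiv ?g1 = [:b, -1:] * pderiv h1 - h1 + smult (1 - b) (pderiv h2)"
      by (rule poly_ext)
        (simp add: pderiv_add pderiv_mult pderiv_smult pderiv_minus pderiv_diff pderiv_pCons)
    moreover have "coeff ([:b, -1:] * pderiv h1) m = 0" "coeff (smult (1 - b) (pderiv h2)) m = 0"
      using that h by (blast intro: lower_degree_derivative)+
    ultimately have "coeff (pderiv ?g1) m = 0"
      using h(1) [OF that] by (simp only: coeff_add coeff_diff) simp
    then show ?thesis
      using h(1) [OF that] by (simp only: coeff_add coeff_minus coeff_smult) simp
  qed
  then have r: "L ([:1, 0, -1:] * (q n * ?r)) = 0"
    by (rule L_q_lower_degree)
  have "?lhs = ([:1, 0, -1:] * pderiv (smult k1 (q n * ?g1)) +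
        [:b * (w1 - w2), - (w1 + w2):] * smult k1 (q n * ?g1)) + [:1, 0, -1:] * (q n * ?r)"
    (is "_ = ?rhs")
  proof (rule poly_ext)
    fix x
    let ?f = "poly (q n) x" and ?h1 = "poly h1 x" and ?h2 = "poly h2 x"
    have "poly ?lhs x - poly ?rhs x =
       ?f * (w1 * (k2 * (1 + b)) * ((1 + b) * ?h1 - (b + x) * ?h2)
         + w2 * (k1 * ((x + b) * ((b - x) * ?h1 + (1 - b) * ?h2) - (1 - x * x) * ?h1)))"
      by (simp add: pderiv_smult pderiv_mult pderiv_add pderiv_minus pderiv_pCons algebra_simps)
    also have "\<dots> = ?f * (w1 * (k2 * (1 + b)) * ((1 + b) * ?h1 - (b + x) * ?h2)
         - w2 * (k1 * (1 - b)) * ((1 + b) * ?h1 - (b + x) * ?h2))"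
      by (simp add: algebra_simps)
    also have "\<dots> = 0"
      unfolding K by (simp add: algebra_simps)
    finally show "poly ?lhs x = poly ?rhs x"
      by simp
  qed
  then show ?thesis
    unfolding param by (simp only: L_add [of _ "[:1, 0, -1:] * (q n * ?r)"] L_pearson r add_0)
qed

definition N1 :: mpoly2 where
  "N1 = mat2 [:a, -1:] [:1 + a:] [:1 - a:] [:-a, -1:]"

lemma act_V_N1:
  "(mat f \<cdot>\<^sub>D V) ** N1 = mat2 ([:1, 0, -1:] * pderiv f + smult u1 ([:a, -1:] * f)) (smult (u1 * (1 + a)) f)
     (smult (u2 * (1 - a)) f) ([:1, 0, -1:] * pderiv f + smult u2 ([:-a, -1:] * f))"
  unfolding act_V N1_def vec_eq_iff forall_2 matrix_matrix_mult_def sum_2 vec_lambda_beta mat2_nth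
  by (intro conjI poly_ext) (simp_all add: algebra_simps)

lemma P_N1:
  "(P n ** N1) $ 1 $ 1 = smult (Binv n $ 1 $ 1) ([:1, 0, -1:] * pderiv (q n) + smult u1 ([:a, -1:] * q n))"
  "(P n ** N1) $ 1 $ 2 = smult (Binv n $ 1 $ 1) (smult (u1 * (1 + a)) (q n))"
  "(P n ** N1) $ 2 $ 1 = smult (Binv n $ 2 $ 2) (smult (u2 * (1 - a)) (q n))"
  "(P n ** N1) $ 2 $ 2 = smult (Binv n $ 2 $ 2) ([:1, 0, -1:] * pderiv (q n) + smult u2 ([:-a, -1:] * q n))"
  unfolding P_def Q_def matrix_mul_assoc [symmetric] act_V_N1
  by (simp_all only: matrix_matrix_mult_def sum_2 Binv_def vec_lambda_beta mpoly_const_nth mat2_nth) simp_all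

text \<open>The matrix inner product for the weight \<open>N1 K N1\<^sup>T\<close>, with \<open>\<sigma>\<close> for the conjugation of coefficients.\<close>

definition pairing :: "(complex poly \<Rightarrow> complex poly) \<Rightarrow> mpoly2 \<Rightarrow> mpoly2 \<Rightarrow> complex^2^2" where
  "pairing \<sigma> R S = (\<chi> i j. L (smult K1 ((R ** N1) $ i $ 1 * \<sigma> ((S ** N1) $ j $ 1)) +
     smult K2 ((R ** N1) $ i $ 2 * \<sigma> ((S ** N1) $ j $ 2))))"

text \<open>\<open>\<sigma>\<close> acts on coefficients and fixes the real polynomials in \<open>N1\<close>; this is all that the
assumptions on it say.\<close>

lemma pairing_P_lower_degree:
  assumes S: "\<And>m. m \<ge> n \<Longrightarrow> mpoly_coeff S m = 0"
    and \<sigma>_0: "\<And>f m. coeff f m = 0 \<Longrightarrow> coeff (\<sigma> f) m = 0"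
    and \<sigma>_S: "\<And>j. \<sigma> ((S ** N1) $ j $ 1) = [:a, -1:] * \<sigma> (S $ j $ 1) + smult (1 - a) (\<sigma> (S $ j $ 2))"
      "\<And>j. \<sigma> ((S ** N1) $ j $ 2) = smult (1 + a) (\<sigma> (S $ j $ 1)) + [:-a, -1:] * \<sigma> (S $ j $ 2)"
  shows "pairing \<sigma> (P n) S = 0"
proof -
  have K: "K1 * (1 - a) = u1 / 2" "K2 * (1 + a) = u2 / 2"
    using nonzero_eq_divide_eq [OF a_nz(2), of K1 "u1 / 2"]
      nonzero_eq_divide_eq [OF a_nz(1), of K2 "u2 / 2"]
    by (simp_all only: K1_def K2_def simp_thms)
  have h: "coeff (\<sigma> (S $ j $ l)) m = 0" if "m \<ge> n" for j l m
    using S [OF that] \<sigma>_0 by (simp add: mpoly_coeff_def vec_eq_iff)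
  let ?b = "\<lambda>i. Binv n $ i $ i"
  have pull: "smult k (smult z f * h) + smult k' (smult z f' * h') = smult z (smult k (f * h) + smult k' (f' * h'))"
    for k k' z :: complex and f f' h h' :: "complex poly"
    by (simp add: smult_add_right mult_ac)
  have "pairing \<sigma> (P n) S $ 1 $ j = 0" for j
  proof -
    have "pairing \<sigma> (P n) S $ 1 $ j = ?b 1 * L (smult K1 (([:1, 0, -1:] * pderiv (q n) + smult u1 ([:a, -1:] * q n)) *
        ([:a, -1:] * \<sigma> (S $ j $ 1) + smult (1 - a) (\<sigma> (S $ j $ 2)))) +
      smult K2 (smult (u1 * (1 + a)) (q n) * (smult (1 + a) (\<sigma> (S $ j $ 1)) + [:-a, -1:] * \<sigma> (S $ j $ 2))))"
      by (simp only: pairing_def vec_lambda_beta P_N1 \<sigma>_S pull L_smult)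
    also have "\<dots> = 0"
      by (simp only: row_orthogonal [OF h h refl refl K] mult_zero_right)
    finally show ?thesis .
  qed
  moreover have "pairing \<sigma> (P n) S $ 2 $ j = 0" for j
  proof -
    have "pairing \<sigma> (P n) S $ 2 $ j = ?b 2 * L (smult K2 (([:1, 0, -1:] * pderiv (q n) + smult u2 ([:-a, -1:] * q n)) *
        ([:-a, -1:] * \<sigma> (S $ j $ 2) + smult (1 - - a) (\<sigma> (S $ j $ 1)))) +
      smult K1 (smult (u2 * (1 + - a)) (q n) * (smult (1 + - a) (\<sigma> (S $ j $ 2)) + [:- (- a), -1:] * \<sigma> (S $ j $ 1))))"
      by (simp only: pairing_def vec_lambda_beta P_N1 \<sigma>_S pull L_smult)
        (simp only: diff_minus_eq_add add_uminus_conv_diff minus_minus add.commute)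
    also have "\<dots> = 0"
    proof -
      have "- a * (u2 - u1) = a * (u1 - u2)" "u2 + u1 = u1 + u2"
        "K2 * (1 - - a) = u2 / 2" "K1 * (1 + - a) = u1 / 2"
        using K by (simp_all add: algebra_simps)
      from row_orthogonal [OF h h this] show ?thesis
        by (simp only: mult_zero_right)
    qed
    finally show ?thesis .
  qed
  ultimately show ?thesis
    by (simp add: vec_eq_iff forall_2)
qed

end

section \<open>The Jacobi integral\<close>

definition jacobi_density :: "real \<Rightarrow> real \<Rightarrow> real \<Rightarrow> real" where
  "jacobi_density \<alpha> \<beta> x = (1 - x) powr \<alpha> * (1 + x) powr \<beta>"

definition jacobi_integral :: "real \<Rightarrow> real \<Rightarrow> complex poly \<Rightarrow> complex" where
  "jacobi_integral \<alpha> \<beta> f =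
    (LBINT x:{-1<..<1}. complex_of_real (jacobi_density \<alpha> \<beta> x) * poly f (complex_of_real x))"

text \<open>The substitution \<open>t = (1 + x) / 2\<close> reduces this to the Beta integral.\<close>

lemma jacobi_density_integrable:
  assumes "\<alpha> > -1" "\<beta> > -1"
  shows "set_integrable lborel {-1<..<1} (jacobi_density \<alpha> \<beta>)"
proof -
  let ?f = "\<lambda>t. t powr \<beta> * (1 - t) powr \<alpha>"
  have "integrable lborel (\<lambda>t. indicat_real {0..1} t *\<^sub>R ?f t)"
    using integrable_Beta [of "\<beta> + 1" "\<alpha> + 1"] assms by (simp add: set_integrable_def)
  from lborel_integrable_real_affine [OF this, of "1 / 2" "1 / 2"]
  have "integrable lborel (\<lambda>x. indicat_real {0..1} (1 / 2 + 1 / 2 * x) *\<^sub>R ?f (1 / 2 + 1 / 2 * x))"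
    by simp
  then have "integrable lborel (\<lambda>x. 2 powr (\<alpha> + \<beta>) *
      (indicat_real {0..1} (1 / 2 + 1 / 2 * x) *\<^sub>R ?f (1 / 2 + 1 / 2 * x)))"
    by (rule integrable_mult_right)
  also have "(\<lambda>x. 2 powr (\<alpha> + \<beta>) *
      (indicat_real {0..1} (1 / 2 + 1 / 2 * x) *\<^sub>R ?f (1 / 2 + 1 / 2 * x))) =
      (\<lambda>x. indicat_real {-1..1} x *\<^sub>R jacobi_density \<alpha> \<beta> x)"
  proof
    fix x :: real
    show "2 powr (\<alpha> + \<beta>) * (indicat_real {0..1} (1 / 2 + 1 / 2 * x) *\<^sub>R ?f (1 / 2 + 1 / 2 * x)) =
        indicat_real {-1..1} x *\<^sub>R jacobi_density \<alpha> \<beta> x"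
    proof (cases "-1 \<le> x \<and> x \<le> 1")
      case True
      have "1 / 2 + 1 / 2 * x = (1 + x) / 2" "1 - (1 + x) / 2 = (1 - x) / 2"
        by (simp_all add: field_simps)
      then have "?f (1 / 2 + 1 / 2 * x) = (1 + x) powr \<beta> / 2 powr \<beta> * ((1 - x) powr \<alpha> / 2 powr \<alpha>)"
        using True by (simp only: powr_divide)
      with True show ?thesis
        by (simp add: jacobi_density_def powr_add indicator_def)
    qed (auto simp: indicator_def)
  qed
  finally have "set_integrable lborel {-1..1} (jacobi_density \<alpha> \<beta>)"
    by (simp add: set_integrable_def)
  then show ?thesis
    by (rule set_integrable_subset) auto
qed

lemma continuous_on_poly_of_real: "continuous_on A (\<lambda>x. poly f (complex_of_real x))"
  by (intro continuous_intros)

lemma jacobi_integrable: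
  assumes "\<alpha> > -1" "\<beta> > -1"
  shows "set_integrable lborel {-1<..<1}
    (\<lambda>x. complex_of_real (jacobi_density \<alpha> \<beta> x) * poly f (complex_of_real x))"
proof -
  have "compact ((\<lambda>x. poly f (complex_of_real x)) ` {-1..1})"
    by (intro compact_continuous_image continuous_on_poly_of_real compact_Icc)
  then obtain C where C: "\<And>x. x \<in> {-1..1} \<Longrightarrow> norm (poly f (complex_of_real x)) \<le> C"
    using compact_imp_bounded bounded_iff by (metis (no_types, lifting) image_eqI)
  have [measurable]: "(\<lambda>x. poly f (complex_of_real x)) \<in> borel_measurable borel"
    by (intro borel_measurable_continuous_onI continuous_on_poly_of_real)
  have "set_integrable lborel {-1<..<1} (\<lambda>x. C * jacobi_density \<alpha> \<beta> x)"
    using jacobi_density_integrable [OF assms] by simp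
  then show ?thesis
  proof (rule set_integrable_bound)
    show "set_borel_measurable lborel {-1<..<1}
        (\<lambda>x. complex_of_real (jacobi_density \<alpha> \<beta> x) * poly f (complex_of_real x))"
      unfolding set_borel_measurable_def jacobi_density_def by measurable
    show "AE x in lborel. x \<in> {-1<..<1} \<longrightarrow>
        norm (complex_of_real (jacobi_density \<alpha> \<beta> x) * poly f (complex_of_real x)) \<le>
        norm (C * jacobi_density \<alpha> \<beta> x)"
    proof (intro AE_I2 impI)
      fix x :: real assume "x \<in> {-1<..<1}"
      then have "norm (poly f (complex_of_real x)) \<le> \<bar>C\<bar>"
        using C [of x] by auto
      then show "norm (complex_of_real (jacobi_density \<alpha> \<beta> x) * poly f (complex_of_real x)) \<le>
        norm (C * jacobi_density \<alpha> \<beta> x)"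
        using mult_right_mono [of "norm (poly f (complex_of_real x))" "\<bar>C\<bar>" "\<bar>jacobi_density \<alpha> \<beta> x\<bar>"]
        by (simp add: norm_mult abs_mult mult.commute)
    qed
  qed
qed

lemma jacobi_integral_add:
  assumes "\<alpha> > -1" "\<beta> > -1"
  shows "jacobi_integral \<alpha> \<beta> (f + g) =
    jacobi_integral \<alpha> \<beta> f + jacobi_integral \<alpha> \<beta> g"
  unfolding jacobi_integral_def
  by (simp add: distrib_left set_integral_add jacobi_integrable [OF assms])

lemma jacobi_integral_smult:
  "jacobi_integral \<alpha> \<beta> (smult k f) = k * jacobi_integral \<alpha> \<beta> f"
  unfolding jacobi_integral_def
  by (simp add: mult.left_commute [of _ k])

lemma jacobi_integral_cnj:
  "jacobi_integral \<alpha> \<beta> (map_poly cnj f) = cnj (jacobi_integral \<alpha> \<beta> f)"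
  unfolding jacobi_integral_def set_lebesgue_integral_def Bochner_Integration.integral_cnj [symmetric]
  by (intro Bochner_Integration.integral_cong refl) simp

text \<open>The integrand is the derivative of \<open>f(x) (1 - x)\<^sup>\<alpha>\<^sup>+\<^sup>1 (1 + x)\<^sup>\<beta>\<^sup>+\<^sup>1\<close>, which tends to zero at both ends of
the interval because \<open>\<alpha> + 1\<close> and \<open>\<beta> + 1\<close> are positive.\<close>

lemma jacobi_integral_pearson:
  assumes "\<alpha> > -1" "\<beta> > -1"
  shows "jacobi_integral \<alpha> \<beta>
    ([:1, 0, -1:] * pderiv f + [:of_real (\<beta> - \<alpha>), - of_real (\<alpha> + \<beta> + 2):] * f) = 0"
proof -
  let ?g = "[:1, 0, -1:] * pderiv f + [:of_real (\<beta> - \<alpha>), - of_real (\<alpha> + \<beta> + 2):] * f"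
  define h where "h x = (1 - x) powr (\<alpha> + 1) * (1 + x) powr (\<beta> + 1)" for x :: real
  define F where "F x = complex_of_real (h x) * poly f (complex_of_real x)" for x :: real
  have "(LBINT x=ereal (-1)..ereal 1. complex_of_real (jacobi_density \<alpha> \<beta> x) * poly ?g (complex_of_real x)) = 0 - 0"
  proof (rule interval_integral_FTC_integrable [where F = F])
    fix x assume "ereal (-1) < ereal x" "ereal x < ereal 1"
    then have x: "-1 < x" "x < 1" by simp_all
    have "(h has_real_derivative jacobi_density \<alpha> \<beta> x * ((\<beta> - \<alpha>) - (\<alpha> + \<beta> + 2) * x)) (at x)"
    proof -
      have "(h has_real_derivative
          (1 - x) powr (\<alpha> + 1) * ((\<beta> + 1) * (1 + x) powr \<beta>)
          - (\<alpha> + 1) * (1 - x) powr \<alpha> * (1 + x) powr (\<beta> + 1)) (at x)"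
        unfolding h_def using x by (auto intro!: derivative_eq_intros simp: algebra_simps)
      moreover have e: "(1 - x) powr (\<alpha> + 1) = (1 - x) powr \<alpha> * (1 - x)" "(1 + x) powr (\<beta> + 1) = (1 + x) powr \<beta> * (1 + x)"
        using x by (simp_all add: powr_add)
      ultimately show ?thesis
        unfolding e by (elim DERIV_cong) (simp add: jacobi_density_def algebra_simps)
    qed
    then have "((\<lambda>x. complex_of_real (h x)) has_vector_derivative
        of_real (jacobi_density \<alpha> \<beta> x * ((\<beta> - \<alpha>) - (\<alpha> + \<beta> + 2) * x))) (at x)"
      by (intro has_vector_derivative_of_real)
        (simp add: has_real_derivative_iff_has_vector_derivative)
    moreover have "((\<lambda>x. poly f (complex_of_real x)) has_vector_derivative poly (pderiv f) (of_real x)) (at x)"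
      by (rule has_vector_derivative_real_field) (rule poly_DERIV)
    ultimately have "(F has_vector_derivative
        of_real (h x) * poly (pderiv f) (of_real x) +
        of_real (jacobi_density \<alpha> \<beta> x * ((\<beta> - \<alpha>) - (\<alpha> + \<beta> + 2) * x)) * poly f (of_real x)) (at x)"
      unfolding F_def by (rule has_vector_derivative_mult)
    also have "h x = jacobi_density \<alpha> \<beta> x * ((1 - x) * (1 + x))"
      using x by (simp add: h_def jacobi_density_def powr_add)
    finally show "(F has_vector_derivative
        complex_of_real (jacobi_density \<alpha> \<beta> x) * poly ?g (complex_of_real x)) (at x)"
      by (rule has_vector_derivative_eq_rhs) (simp add: algebra_simps)
    show "isCont (\<lambda>x. complex_of_real (jacobi_density \<alpha> \<beta> x) * poly ?g (complex_of_real x)) x"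
      unfolding jacobi_density_def using x by (intro continuous_intros) auto
  next
    show "set_integrable lborel (einterval (ereal (-1)) (ereal 1))
        (\<lambda>x. complex_of_real (jacobi_density \<alpha> \<beta> x) * poly ?g (complex_of_real x))"
      using jacobi_integrable [OF assms, of ?g] by (simp only: einterval_eq_Icc)
  next
    have "((\<lambda>x. (1 - x) powr (\<alpha> + 1)) \<longlongrightarrow> (1 - (-1)) powr (\<alpha> + 1)) (at_right (-1))"
      by (intro tendsto_intros) auto
    moreover have "((\<lambda>x::real. (1 + x) powr (\<beta> + 1)) \<longlongrightarrow> 0) (at_right (-1))"
    proof (rule tendsto_zero_powrI)
      have "((\<lambda>x::real. 1 + x) \<longlongrightarrow> 1 + (-1)) (at_right (-1))"
        by (intro tendsto_intros)
      then show "((\<lambda>x::real. 1 + x) \<longlongrightarrow> 0) (at_right (-1))" by simp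
    qed (use assms in \<open>auto intro!: tendsto_intros simp: eventually_at_filter\<close>)
    ultimately have "(h \<longlongrightarrow> (1 - (-1)) powr (\<alpha> + 1) * 0) (at_right (-1))"
      unfolding h_def by (rule tendsto_mult)
    then have "((\<lambda>x. of_real (h x) * poly f (complex_of_real x)) \<longlongrightarrow> of_real 0 * poly f (complex_of_real (-1))) (at_right (-1))"
      by (intro tendsto_intros) auto
    then show "((F \<circ> real_of_ereal) \<longlongrightarrow> 0) (at_right (ereal (-1)))"
      unfolding F_def ereal_tendsto_simps1 by simp
  next
    have "((\<lambda>x. (1 + x) powr (\<beta> + 1)) \<longlongrightarrow> (1 + 1) powr (\<beta> + 1)) (at_left (1::real))"
      by (intro tendsto_intros) auto
    moreover have "((\<lambda>x::real. (1 - x) powr (\<alpha> + 1)) \<longlongrightarrow> 0) (at_left 1)"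
    proof (rule tendsto_zero_powrI)
      have "((\<lambda>x::real. 1 - x) \<longlongrightarrow> 1 - 1) (at_left 1)"
        by (intro tendsto_intros)
      then show "((\<lambda>x::real. 1 - x) \<longlongrightarrow> 0) (at_left 1)" by simp
    qed (use assms in \<open>auto intro!: tendsto_intros simp: eventually_at_filter\<close>)
    ultimately have "(h \<longlongrightarrow> 0 * (1 + 1) powr (\<beta> + 1)) (at_left 1)"
      unfolding h_def by (intro tendsto_mult)
    then have "((\<lambda>x. of_real (h x) * poly f (complex_of_real x)) \<longlongrightarrow> of_real 0 * poly f (complex_of_real 1)) (at_left 1)"
      by (intro tendsto_intros) auto
    then show "((F \<circ> real_of_ereal) \<longlongrightarrow> 0) (at_left (ereal 1))"
      unfolding F_def ereal_tendsto_simps1 by simp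
  qed simp
  moreover have "(LBINT x=ereal (-1)..ereal 1. k x) = (LBINT x:{-1<..<1}. k x)" for k :: "real \<Rightarrow> complex"
    by (simp add: interval_lebesgue_integral_def)
  ultimately show ?thesis
    by (simp only: jacobi_integral_def) simp
qed

lemma jacobi_integral_square:
  "jacobi_integral \<alpha> \<beta> (f * map_poly cnj f) =
    of_real (LBINT x:{-1<..<1}. jacobi_density \<alpha> \<beta> x * (cmod (poly f (of_real x)))\<^sup>2)"
  unfolding jacobi_integral_def
  by (simp add: complex_norm_square [symmetric] del: of_real_power flip: set_integral_complex_of_real)

lemma jacobi_square_integrable:
  assumes "\<alpha> > -1" "\<beta> > -1"
  shows "set_integrable lborel {-1<..<1} (\<lambda>x. jacobi_density \<alpha> \<beta> x * (cmod (poly f (of_real x)))\<^sup>2)"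
proof -
  have "set_integrable lborel {-1<..<1}
      (\<lambda>x. complex_of_real (jacobi_density \<alpha> \<beta> x * (cmod (poly f (of_real x)))\<^sup>2))"
    using jacobi_integrable [OF assms, of "f * map_poly cnj f"]
    by (simp add: complex_norm_square [symmetric] del: of_real_power)
  moreover have "indicat_real A x *\<^sub>R complex_of_real y = complex_of_real (indicat_real A x *\<^sub>R y)" for A :: "real set" and x y
    by (simp add: scaleR_conv_of_real)
  ultimately show ?thesis
    by (simp only: set_integrable_def complex_of_real_integrable_eq)
qed

lemma jacobi_square_nonneg:
  "(LBINT x:{-1<..<1}. jacobi_density \<alpha> \<beta> x * (cmod (poly f (of_real x)))\<^sup>2) \<ge> 0"
  unfolding set_lebesgue_integral_def jacobi_density_def
  by (rule Bochner_Integration.integral_nonneg) auto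

text \<open>The density is positive on the interval, so the integrand vanishes almost everywhere only if \<open>f\<close>
does, and a nonzero polynomial has finitely many roots.\<close>

lemma jacobi_square_eq_0:
  assumes "\<alpha> > -1" "\<beta> > -1"
    and "(LBINT x:{-1<..<1}. jacobi_density \<alpha> \<beta> x * (cmod (poly f (of_real x)))\<^sup>2) = 0"
  shows "f = 0"
proof (rule ccontr)
  assume "f \<noteq> 0"
  then have "finite {z. poly f z = 0}"
    by (rule poly_roots_finite)
  then have "finite (complex_of_real -` {z. poly f z = 0})"
    by (rule finite_vimageI) (simp add: inj_of_real)
  from AE_not_in [OF finite_imp_null_set_lborel [OF this]]
  have roots: "AE x in lborel. poly f (complex_of_real x) \<noteq> 0"
    by simp
  have "AE x in lborel. indicat_real {-1<..<1} x *\<^sub>R (jacobi_density \<alpha> \<beta> x * (cmod (poly f (of_real x)))\<^sup>2) = 0"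
    using jacobi_square_integrable [OF assms(1,2), of f] assms(3)
    unfolding set_lebesgue_integral_def set_integrable_def
    by (subst (asm) integral_nonneg_eq_0_iff_AE) (auto simp: jacobi_density_def)
  with roots have "AE x in lborel. x \<notin> {-1<..<1::real}"
    by eventually_elim (auto simp: jacobi_density_def indicator_def split: if_splits)
  then have "{-1<..<1::real} \<in> null_sets lborel"
    by (simp add: AE_iff_null_sets)
  then show False
    by (simp add: null_sets_def)
qed

lemma set_integral_entries:
  fixes g :: "real \<Rightarrow> complex^2^2"
  assumes "\<And>i j. set_integrable lborel A (\<lambda>x. g x $ i $ j)"
  shows "(LBINT x:A. g x) $ i $ j = (LBINT x:A. g x $ i $ j)"
proof -
  let ?h = "\<lambda>x. indicat_real A x *\<^sub>R g x"
  have lin: "bounded_linear (\<lambda>z :: complex. axis i (axis j z) :: complex^2^2)" for i j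
    by (rule linear_conv_bounded_linear [THEN iffD1])
      (auto simp: linear_iff axis_def vec_eq_iff)
  have "?h = (\<lambda>x. \<Sum>i\<in>UNIV. \<Sum>j\<in>UNIV. axis i (axis j (indicat_real A x *\<^sub>R g x $ i $ j)))"
    by (simp add: fun_eq_iff vec_eq_iff axis_def forall_2 sum_2)
  moreover have "integrable lborel (\<lambda>x. \<Sum>i\<in>UNIV. \<Sum>j\<in>UNIV. axis i (axis j (indicat_real A x *\<^sub>R g x $ i $ j)) :: complex^2^2)"
    using assms unfolding set_integrable_def
    by (intro Bochner_Integration.integrable_sum integrable_bounded_linear [OF lin])
  ultimately have "integrable lborel ?h"
    by (simp only:)
  moreover have "bounded_linear (\<lambda>m :: complex^2^2. m $ i $ j)"
    by (rule linear_conv_bounded_linear [THEN iffD1]) (auto simp: linear_iff)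
  ultimately have "integral\<^sup>L lborel ?h $ i $ j = (\<integral>x. ?h x $ i $ j \<partial>lborel)"
    using integral_bounded_linear [of "\<lambda>m. m $ i $ j" lborel ?h] by simp
  then show ?thesis
    by (simp add: set_lebesgue_integral_def)
qed

section \<open>The matrix weight and its orthogonal polynomials\<close>

locale jacobi_parameters =
  fixes \<alpha> \<beta> v :: real
  assumes v_lower: "\<bar>\<alpha> - \<beta>\<bar> < \<bar>v\<bar>" and v_upper: "\<bar>v\<bar> < \<alpha> + \<beta> + 2"
begin

text \<open>The real numbers behind the parameters \<open>u1\<close>, \<open>u2\<close>, \<open>a\<close> of the algebraic part.\<close>

definition t1 :: real where "t1 = (v + 2 + \<alpha> + \<beta>) / 2"
definition t2 :: real where "t2 = (- v + 2 + \<alpha> + \<beta>) / 2"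
definition s :: real where "s = (\<beta> - \<alpha>) / v"

lemma v_nz: "v \<noteq> 0"
  using v_lower by auto

lemma t_pos: "t1 > 0" "t2 > 0"
  using v_upper by (auto simp: t1_def t2_def)

lemma s_bound: "1 + s > 0" "1 - s > 0"
proof -
  have "\<bar>s\<bar> < 1"
    using v_lower v_nz by (simp add: s_def abs_divide abs_minus_commute)
  then show "1 + s > 0" "1 - s > 0" by auto
qed

lemma v_eq: "v = t1 - t2"
  by (simp add: t1_def t2_def field_simps)

lemma s_mult: "s * (t1 - t2) = \<beta> - \<alpha>"
  using v_nz by (simp add: s_def flip: v_eq)

lemma t_sum: "t1 + t2 = \<alpha> + \<beta> + 2"
  by (simp add: t1_def t2_def field_simps)

lemma exponents: "\<alpha> > -1" "\<beta> > -1"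
  using v_lower v_upper by auto

sublocale jacobi_functional "complex_of_real t1" "complex_of_real t2" "complex_of_real s"
  "jacobi_integral \<alpha> \<beta>"
proof
  fix n :: nat
  have of_real: "of_nat n + complex_of_real t = complex_of_real (of_nat n + t)" for t
    by simp
  have pos: "of_nat n + complex_of_real t \<noteq> 0" if "t > 0" for t
    unfolding of_real of_real_eq_0_iff using that by (simp add: add_nonneg_pos less_imp_neq [symmetric])
  show "of_nat n + complex_of_real t1 \<noteq> 0" "of_nat n + complex_of_real t2 \<noteq> 0"
    by (rule pos, rule t_pos)+
  show "of_nat n + (complex_of_real t1 + complex_of_real t2 + 1) \<noteq> 0"
    using pos [of "t1 + t2 + 1"] t_pos by simp
  show "of_nat n + ((1 - complex_of_real s) * complex_of_real t1 +
      (1 + complex_of_real s) * complex_of_real t2) / 2 \<noteq> 0"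
    using pos [of "((1 - s) * t1 + (1 + s) * t2) / 2"] t_pos s_bound
    by (simp add: add_pos_pos)
  show "complex_of_real t1 \<noteq> complex_of_real t2"
    using v_nz v_eq by auto
  have "complex_of_real (1 + s) \<noteq> 0" "complex_of_real (1 - s) \<noteq> 0"
    using s_bound by (simp_all only: of_real_eq_0_iff)
  then show "1 + complex_of_real s \<noteq> 0" "1 - complex_of_real s \<noteq> 0"
    by simp_all
next
  fix f h :: "complex poly" and k :: complex
  show "jacobi_integral \<alpha> \<beta> (f + h) =
      jacobi_integral \<alpha> \<beta> f + jacobi_integral \<alpha> \<beta> h"
    by (rule jacobi_integral_add [OF exponents])
  show "jacobi_integral \<alpha> \<beta> (smult k f) = k * jacobi_integral \<alpha> \<beta> f"
    by (rule jacobi_integral_smult)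
  have "complex_of_real (\<beta> - \<alpha>) = complex_of_real s * (complex_of_real t1 - complex_of_real t2)"
    "complex_of_real (\<alpha> + \<beta> + 2) = complex_of_real t1 + complex_of_real t2"
    unfolding s_mult [symmetric] t_sum [symmetric] by simp_all
  then show "jacobi_integral \<alpha> \<beta> ([:1, 0, -1:] * pderiv f +
      [:complex_of_real s * (complex_of_real t1 - complex_of_real t2),
        - (complex_of_real t1 + complex_of_real t2):] * f) = 0"
    using jacobi_integral_pearson [OF exponents, of f] by simp
qed

lemma op_V_eq: "op_V \<alpha> \<beta> v = V"
proof -
  have "(\<alpha> - \<beta>) / v = - s"
    using v_nz by (simp add: s_def field_simps)
  then show ?thesis
    unfolding op_V_def V_def t1_def [symmetric] t2_def [symmetric] s_def [symmetric] by simp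
qed

lemma op_N_eq: "op_N \<alpha> \<beta> v = N"
proof -
  have "(\<alpha> - \<beta>) / v = - s"
    using v_nz by (simp add: s_def field_simps)
  moreover have e: "- (- v + 4 + \<alpha> + \<beta>) / 2 = - (t2 + 1)" "- (\<alpha> + \<beta> + v + 4) / 2 = - (t1 + 1)"
    by (simp_all add: t1_def t2_def field_simps)
  ultimately show ?thesis
    unfolding op_N_def N_def s_def [symmetric] e by simp
qed

definition k1 :: real where "k1 = t1 / 2 / (1 - s)"
definition k2 :: real where "k2 = t2 / 2 / (1 + s)"

lemma K_eq: "K1 = complex_of_real k1" "K2 = complex_of_real k2"
  by (simp_all add: K1_def K2_def k1_def k2_def)

lemma k_pos: "k1 > 0" "k2 > 0"
  using t_pos s_bound by (simp_all add: k1_def k2_def)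

text \<open>The factorization \<open>N1 K N1\<^sup>T\<close> of the polynomial part of the weight, multiplied out.\<close>

lemma weight_factor:
  "((1 - x)\<^sup>2 / 4) *\<^sub>R jacobi_W2 \<alpha> \<beta> v + ((1 - x) / 2) *\<^sub>R jacobi_W1 \<alpha> \<beta> v + jacobi_W0 \<alpha> =
    mat2 (k1 * (s - x)\<^sup>2 + k2 * (1 + s)\<^sup>2) (k1 * (s - x) * (1 - s) - k2 * (1 + s) * (s + x))
      (k1 * (s - x) * (1 - s) - k2 * (1 + s) * (s + x)) (k1 * (1 - s)\<^sup>2 + k2 * (s + x)\<^sup>2)"
proof -
  have "v + \<alpha> - \<beta> = v * (1 - s)" "v - \<alpha> + \<beta> = v * (1 + s)"
    using s_mult by (simp_all add: algebra_simps flip: v_eq)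
  moreover have quarter: "4 * (x / 2 / 2 / y) = x / y" for x y :: real
    by simp
  ultimately have W2: "v * (v + 2 + \<alpha> + \<beta>) / (v + \<alpha> - \<beta>) = 4 * k1" "v * (- v + 2 + \<alpha> + \<beta>) / (v - \<alpha> + \<beta>) = 4 * k2"
    using v_nz quarter [of "v + 2 + \<alpha> + \<beta>" "1 - s"] quarter [of "- v + 2 + \<alpha> + \<beta>" "1 + s"]
    by (simp_all only: k1_def k2_def t1_def t2_def mult_divide_mult_cancel_left [OF v_nz])
  have W1: "v + \<alpha> + \<beta> + 2 = 2 * t1" "- v + \<alpha> + \<beta> + 2 = 2 * t2" "\<alpha> + \<beta> + 2 = t1 + t2"
    by (simp_all add: t1_def t2_def field_simps)
  have unhalve: "x = 2 * (x / 2 / y * y)" if "y > 0" for x y :: real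
    using that by simp
  have t: "t1 = 2 * (k1 * (1 - s))" "t2 = 2 * (k2 * (1 + s))"
    unfolding k1_def k2_def by (rule unhalve, rule s_bound)+
  have "\<alpha> + 1 = ((1 - s) * t1 + (1 + s) * t2) / 2"
    using s_mult t_sum by (simp add: algebra_simps)
  also have "\<dots> = k1 * (1 - s)\<^sup>2 + k2 * (1 + s)\<^sup>2"
    by (subst t(1), subst t(2)) (simp add: power2_eq_square)
  finally have W0: "\<alpha> + 1 = k1 * (1 - s)\<^sup>2 + k2 * (1 + s)\<^sup>2"
    "- \<alpha> - 1 = - (k1 * (1 - s)\<^sup>2 + k2 * (1 + s)\<^sup>2)"
    by simp_all
  show ?thesis
    unfolding jacobi_W2_def jacobi_W1_def jacobi_W0_def W2 W1 W0 vec_eq_iff forall_2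
    unfolding t
    by (simp add: power2_eq_square algebra_simps add_divide_distrib diff_divide_distrib)
qed

abbreviation W :: "real \<Rightarrow> complex^2^2" where "W \<equiv> jacobi_weight \<alpha> \<beta> v"

lemma weight_entry:
  "W x $ i $ j = of_real (jacobi_density \<alpha> \<beta> x) *
    (K1 * poly (N1 $ i $ 1) (of_real x) * poly (N1 $ j $ 1) (of_real x) +
     K2 * poly (N1 $ i $ 2) (of_real x) * poly (N1 $ j $ 2) (of_real x))"
proof -
  have "i = 1 \<or> i = 2" "j = 1 \<or> j = 2"
    using exhaust_2 [of i] exhaust_2 [of j] by auto
  then show ?thesis
    unfolding jacobi_weight_def weight_factor
    by (auto simp: map_matrix_def N1_def K_eq jacobi_density_def power2_eq_square algebra_simps)
qed

lemma cnj_N1: "cnj (poly (N1 $ i $ j) (of_real x)) = poly (N1 $ i $ j) (of_real x)"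
  using exhaust_2 [of i] exhaust_2 [of j] by (auto simp: N1_def)

lemma integrand_entry:
  "(mpoly_eval R x ** W x ** conj_transpose (mpoly_eval S x)) $ i $ j =
    of_real (jacobi_density \<alpha> \<beta> x) *
    poly (smult K1 ((R ** N1) $ i $ 1 * map_poly cnj ((S ** N1) $ j $ 1)) +
      smult K2 ((R ** N1) $ i $ 2 * map_poly cnj ((S ** N1) $ j $ 2))) (of_real x)"
  by (simp add: matrix_matrix_mult_def sum_2 weight_entry mpoly_eval_def conj_transpose_def cnj_N1 algebra_simps)

abbreviation "inner_W \<equiv> pairing (map_poly cnj)"

lemma weight_inner_eq: "weight_inner W R S = inner_W R S"
proof -
  have "set_integrable lborel {-1<..<1}
      (\<lambda>x. (mpoly_eval R x ** W x ** conj_transpose (mpoly_eval S x)) $ i $ j)" for i j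
    unfolding integrand_entry by (rule jacobi_integrable [OF exponents])
  then have "weight_inner W R S $ i $ j = inner_W R S $ i $ j" for i j
    unfolding weight_inner_def pairing_def jacobi_integral_def
    by (subst set_integral_entries) (simp_all only: integrand_entry vec_lambda_beta)
  then show ?thesis
    by (simp add: vec_eq_iff)
qed

lemma inner_W_P_lower_degree:
  assumes "\<And>m. m \<ge> n \<Longrightarrow> mpoly_coeff S m = 0"
  shows "inner_W (P n) S = 0"
proof (rule pairing_P_lower_degree [OF assms])
  show "coeff (map_poly cnj f) m = 0" if "coeff f m = 0" for f m
    using that by (simp add: coeff_map_poly)
  show "map_poly cnj ((S ** N1) $ j $ 1) = [:of_real s, -1:] * map_poly cnj (S $ j $ 1) +
      smult (1 - of_real s) (map_poly cnj (S $ j $ 2))" for j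
    by (rule poly_ext) (simp add: matrix_matrix_mult_def sum_2 N1_def algebra_simps)
  show "map_poly cnj ((S ** N1) $ j $ 2) = smult (1 + of_real s) (map_poly cnj (S $ j $ 1)) +
      [:- of_real s, -1:] * map_poly cnj (S $ j $ 2)" for j
    by (rule poly_ext) (simp add: matrix_matrix_mult_def sum_2 N1_def algebra_simps)
qed

lemma inner_W_hermitian: "inner_W S R $ j $ i = cnj (inner_W R S $ i $ j)"
proof -
  have "map_poly cnj (smult K1 (f * map_poly cnj g) + smult K2 (f' * map_poly cnj g')) =
      smult K1 (g * map_poly cnj f) + smult K2 (g' * map_poly cnj f')" for f f' g g'
    by (rule poly_ext) (simp add: K_eq)
  then show ?thesis
    unfolding pairing_def vec_lambda_beta jacobi_integral_cnj [symmetric] by simp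
qed

lemma P_is_monic_OPS: "is_monic_OPS W P"
proof -
  have lower: "inner_W (P n) (P m) = 0" if "m < n" for m n
    using that mpoly_monic_coeff(2) [OF P_monic] by (intro inner_W_P_lower_degree) simp
  have "inner_W (P m) (P n) = 0" if "m \<noteq> n" for m n
  proof (cases "m < n")
    case True
    show ?thesis
      unfolding vec_eq_iff using inner_W_hermitian [of "P m" "P n"] lower [OF True] by simp
  next
    case False
    with that show ?thesis by (intro lower) simp
  qed
  then show ?thesis
    by (simp add: is_monic_OPS_def P_monic weight_inner_eq)
qed

lemma inner_W_add_right: "inner_W R (S + S') = inner_W R S + inner_W R S'"
proof -
  have "((S + S') ** N1) $ i $ j = (S ** N1) $ i $ j + (S' ** N1) $ i $ j" for i j
    by (simp add: matrix_matrix_mult_def sum_2 algebra_simps)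
  moreover have "smult K1 (f * map_poly cnj (g + h)) + smult K2 (f' * map_poly cnj (g' + h')) =
      (smult K1 (f * map_poly cnj g) + smult K2 (f' * map_poly cnj g')) +
      (smult K1 (f * map_poly cnj h) + smult K2 (f' * map_poly cnj h'))" for f f' g g' h h'
    by (rule poly_ext) (simp add: algebra_simps)
  ultimately show ?thesis
    by (simp add: vec_eq_iff pairing_def L_add [symmetric])
qed

lemma inner_W_diff_left: "inner_W (R - R') S = inner_W R S - inner_W R' S"
proof -
  have "((R - R') ** N1) $ i $ j = (R ** N1) $ i $ j - (R' ** N1) $ i $ j" for i j
    by (simp add: matrix_matrix_mult_def sum_2 algebra_simps)
  moreover have "smult K1 ((f - g) * h) + smult K2 ((f' - g') * h') =
      (smult K1 (f * h) + smult K2 (f' * h')) - (smult K1 (g * h) + smult K2 (g' * h'))" for f f' g g' h h'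
    by (rule poly_ext) (simp add: algebra_simps)
  ultimately show ?thesis
    by (simp add: vec_eq_iff pairing_def L_diff [symmetric])
qed

lemma inner_W_const_right: "inner_W R (mpoly_const C ** S) = inner_W R S ** conj_transpose C"
proof -
  have "smult K1 (f * map_poly cnj (smult c g + smult d h)) + smult K2 (f' * map_poly cnj (smult c g' + smult d h')) =
      smult (cnj c) (smult K1 (f * map_poly cnj g) + smult K2 (f' * map_poly cnj g')) +
      smult (cnj d) (smult K1 (f * map_poly cnj h) + smult K2 (f' * map_poly cnj h'))" for f f' g g' h h' c d
    by (rule poly_ext) (simp add: algebra_simps)
  moreover have "(mpoly_const C ** S ** N1) $ j $ k =
      smult (C $ j $ 1) ((S ** N1) $ 1 $ k) + smult (C $ j $ 2) ((S ** N1) $ 2 $ k)" for j k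
    by (simp add: matrix_mul_assoc [symmetric]) (simp add: matrix_matrix_mult_def [of "mpoly_const C"] sum_2)
  moreover have "(X ** conj_transpose C) $ i $ j = cnj (C $ j $ 1) * X $ i $ 1 + cnj (C $ j $ 2) * X $ i $ 2"
    for X :: "complex^2^2" and i j
    by (simp add: matrix_matrix_mult_def sum_2 conj_transpose_def mult.commute)
  ultimately show ?thesis
    by (simp only: vec_eq_iff pairing_def L_add [symmetric] L_smult [symmetric] vec_lambda_beta) simp
qed

text \<open>A diagonal entry of the inner product is \<open>k1 \<parallel>f\<parallel>\<^sup>2 + k2 \<parallel>g\<parallel>\<^sup>2\<close> with \<open>(f, g)\<close> a row of \<open>R ** N1\<close>, and \<open>N1\<close> can
be cancelled because its determinant is \<open>x\<^sup>2 - 1\<close>.\<close>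

lemma inner_W_definite:
  assumes "inner_W R R = 0"
  shows "R = 0"
proof -
  let ?n = "\<lambda>f. LBINT x:{-1<..<1}. jacobi_density \<alpha> \<beta> x * (cmod (poly f (of_real x)))\<^sup>2"
  have zero: "(R ** N1) $ i $ 1 = 0 \<and> (R ** N1) $ i $ 2 = 0" for i
  proof -
    let ?f = "(R ** N1) $ i $ 1" and ?g = "(R ** N1) $ i $ 2"
    have diag: "inner_W R R $ i $ i = complex_of_real (k1 * ?n ?f + k2 * ?n ?g)"
      by (simp add: pairing_def L_add L_smult jacobi_integral_square K_eq)
    have "k1 * ?n ?f + k2 * ?n ?g = 0"
      by (rule of_real_eq_0_iff [THEN iffD1], rule trans [OF diag [symmetric]]) (simp only: assms zero_index)
    moreover have "k1 * ?n ?f \<ge> 0" "k2 * ?n ?g \<ge> 0"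
      using k_pos jacobi_square_nonneg by (simp_all add: less_imp_le)
    ultimately have "k1 * ?n ?f = 0" "k2 * ?n ?g = 0"
      by linarith+
    then have "?n ?f = 0" "?n ?g = 0"
      using k_pos by simp_all
    then show ?thesis
      using jacobi_square_eq_0 [OF exponents] by blast
  qed
  have "R ** N1 = 0"
    unfolding vec_eq_iff forall_2 using zero by simp
  then have "R ** (N1 ** mat2 [:of_real s, 1:] [:1 + of_real s:] [:1 - of_real s:] [:- of_real s, 1:]) = 0"
    by (simp add: matrix_mul_assoc)
  then have "mat [:1, 0, -1:] ** R = 0"
    by (simp only: N1_def V_factor mat_commute)
  then have "[:1, 0, -1:] * R $ i $ j = 0" for i j
    using mat_mult_nth [of "[:1, 0, -1:]" R i j] by simp
  then show ?thesis
    by (simp only: mult_eq_0_iff vec_eq_iff) simp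
qed

lemma inner_W_zero_right [simp]: "inner_W R 0 = 0"
  using inner_W_add_right [of R 0 0] by simp

lemma inner_W_sum_right: "inner_W R (\<Sum>x\<in>I. S x) = (\<Sum>x\<in>I. inner_W R (S x))"
  by (induction I rule: infinite_finite_induct) (simp_all add: inner_W_add_right)

text \<open>Uniqueness of the monic orthogonal sequence: the difference of two monic orthogonal polynomials
of degree \<open>n\<close> has lower degree, hence is orthogonal to both of them, hence to itself.\<close>

lemma monic_OPS_eq: "monic_OPS W = P"
  unfolding monic_OPS_def
proof (rule the_equality [of "is_monic_OPS W", OF P_is_monic_OPS])
  fix P' assume P': "is_monic_OPS W P'"
  then have monic: "mpoly_monic n (P' n)" and orth: "m \<noteq> n \<Longrightarrow> inner_W (P' m) (P' n) = 0" for m n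
    by (auto simp: is_monic_OPS_def weight_inner_eq)
  have "P' n = P n" for n
  proof -
    have low: "mpoly_coeff (P' n - P n) m = 0" if "m \<ge> n" for m
      using that monic [of n] P_monic [of n]
      by (cases "m = n") (simp_all add: mpoly_coeff_diff mpoly_monic_def)
    obtain C where C: "P' n - P n = (\<Sum>m<n. mpoly_const (C m) ** P' m)"
      using monic_expansion [of P', OF monic low] by blast
    have "inner_W (P' n) (P' n - P n) = 0"
    proof -
      have "inner_W (P' n) (mpoly_const (C m) ** P' m) = 0" if "m < n" for m
        unfolding inner_W_const_right using orth [of n m] that
        by (simp add: matrix_matrix_mult_def vec_eq_iff)
      then show ?thesis
        unfolding C inner_W_sum_right by (intro sum.neutral) auto
    qed
    moreover have "inner_W (P n) (P' n - P n) = 0"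
      using low by (rule inner_W_P_lower_degree)
    ultimately have "inner_W (P' n - P n) (P' n - P n) = 0"
      by (simp add: inner_W_diff_left)
    then have "P' n - P n = 0"
      by (rule inner_W_definite)
    then show ?thesis by simp
  qed
  then show "P' = P" by blast
qed

lemma op_algebra_eq: "op_algebra W = alg"
  by (simp add: op_algebra_def monic_OPS_eq alg_def)

lemma generators_eq:
  "{op_one, op_D1 \<alpha> \<beta> v, op_D2 \<alpha> \<beta> v, op_D3 \<alpha> \<beta> v, op_D4 \<alpha> \<beta> v,
    op_D5 \<alpha> \<beta> v \<otimes>\<^sub>D op_D1 \<alpha> \<beta> v, op_D5 \<alpha> \<beta> v \<otimes>\<^sub>D op_D2 \<alpha> \<beta> v,
    op_D5 \<alpha> \<beta> v \<otimes>\<^sub>D op_D3 \<alpha> \<beta> v, op_D5 \<alpha> \<beta> v \<otimes>\<^sub>D op_D4 \<alpha> \<beta> v} = generators"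
proof -
  have const: "mpoly_const (mat2 1 0 0 0) = mat2 1 0 0 0" "mpoly_const (mat2 0 1 0 0) = mat2 0 1 0 0"
    "mpoly_const (mat2 0 0 1 0) = mat2 0 0 1 0" "mpoly_const (mat2 0 0 0 1) = mat2 0 0 0 1"
    by (simp_all add: vec_eq_iff forall_2 pCons_one)
  have "op_D1 \<alpha> \<beta> v = sandwich (mat2 1 0 0 0)" "op_D2 \<alpha> \<beta> v = sandwich (mat2 0 1 0 0)"
    "op_D3 \<alpha> \<beta> v = sandwich (mat2 0 0 1 0)" "op_D4 \<alpha> \<beta> v = sandwich (mat2 0 0 0 1)"
    by (simp_all add: op_D1_def op_D2_def op_D3_def op_D4_def op_V_eq op_N_eq sandwich_def const)
  then show ?thesis
    by (simp add: generators_def Let_def op_D5_def)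
qed

end

theorem theorem7p7:
  fixes \<alpha> \<beta> v :: real
  assumes "\<bar>\<alpha> - \<beta>\<bar> < \<bar>v\<bar>" and "\<bar>v\<bar> < \<alpha> + \<beta> + 2"
  shows "op_algebra (jacobi_weight \<alpha> \<beta> v) =
    op_module_span (op_center (op_algebra (jacobi_weight \<alpha> \<beta> v)))
      {op_one,
       op_D1 \<alpha> \<beta> v, op_D2 \<alpha> \<beta> v, op_D3 \<alpha> \<beta> v, op_D4 \<alpha> \<beta> v,
       op_D5 \<alpha> \<beta> v \<otimes>\<^sub>D op_D1 \<alpha> \<beta> v, op_D5 \<alpha> \<beta> v \<otimes>\<^sub>D op_D2 \<alpha> \<beta> v,
       op_D5 \<alpha> \<beta> v \<otimes>\<^sub>D op_D3 \<alpha> \<beta> v, op_D5 \<alpha> \<beta> v \<otimes>\<^sub>D op_D4 \<alpha> \<beta> v}"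
proof -
  interpret jacobi_parameters \<alpha> \<beta> v
    by unfold_locales (fact assms)+
  show ?thesis
    unfolding op_algebra_eq generators_eq by (rule alg_eq_span)
qed

end
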